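(* Let $\mathbb{K}$ be a field and let $D=(D,\vdash,\dashv,E)$ be a generalized digroup. Let $\mathsf{Rep}(D)$ be the category of representations of $D$ over $\mathbb{K}$ and let $A_D$ be the enveloping algebra of $D$. Then there is an equivalence of categories $$\mathsf{Rep}(D)\simeq A_D\text{-}\mathsf{Mod},$$ where $A_D\text{-}\mathsf{Mod}$ denotes the category of left $A_D$-modules.
   Context: A generalized digroup is a quadruple $(D,\vdash,\dashv,E)$ where $D$ is a nonempty set, $\vdash,\dashv:D\times D\to D$ are two associative binary operations, and $E\subseteq D$ is a nonempty subset (the halo, or set of bar-units), such that: (1) for all $e\in E$, $x\in D$: $x\dashv e=x$ and $e\vdash x=x$; (2) for all $e\in E$, $x\in D$ there exist $x^{-1}_{l_e},x^{-1}_{r_e}\in D$ with $x^{-1}_{l_e}\dashv x=e$ and $x\vdash x^{-1}_{r_e}=e$; (3) for all $x,y,z\in D$: $x\vdash(y\dashv z)=(x\vdash y)\dashv z$, $x\dashv(y\dashv z)=x\dashv(y\vdash z)$, $(x\vdash y)\vdash z=(x\dashv y)\vdash z$. A representation of $D$ over $\mathbb{K}$ is a triple $(V,\lambda,\rho)$ where $V$ is a $\mathbb{K}$-vector space and $\lambda:D\to\operatorname{End}(V)$, $\rho:D\to\operatorname{Aut}(V)$ are maps such that for all $x,y\in D$, $e\in E$: $\lambda_{x\dashv y}=\lambda_x\lambda_y$, $\rho_{x\vdash y}=\rho_x\rho_y$, $\rho_e=\mathrm{id}_V$, $\rho_x\lambda_y=\lambda_{x\vdash y}$, $\lambda_x\rho_y=\lambda_{x\dashv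 y}$. A morphism $(V,\lambda,\rho)\to(W,\lambda',\rho')$ is a $\mathbb{K}$-linear map $f:V\to W$ with $f\lambda_x=\lambda'_xf$ and $f\rho_x=\rho'_xf$ for all $x\in D$. These form the category $\mathsf{Rep}(D)$. The enveloping algebra $A_D$ is the quotient of the free unital associative $\mathbb{K}$-algebra on the symbols $L_x,R_x$ ($x\in D$) by the two-sided ideal generated by the elements $L_{x\dashv y}-L_xL_y$, $R_{x\vdash y}-R_xR_y$, $R_e-1$, $R_xL_y-L_{x\vdash y}$, $L_xR_y-L_{x\dashv y}$ for all $x,y\in D$ and $e\in E$. *)

theory Defs
  imports "HOL-Library.FuncSet" "HOL-Algebra.Module" "HOL-Algebra.QuotRing"
begin

section \<open>Categories, functors and equivalences\<close>

text \<open>Hom-sets need not be disjoint, so composition and the action of a functor on arrows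
  take the objects involved as arguments. Composition is in applicative order:
  \<open>comp C X Y Z g f\<close> is \<open>g \<circ> f\<close> for \<open>f : X \<rightarrow> Y\<close> and \<open>g : Y \<rightarrow> Z\<close>.\<close>

record ('o, 'm) category =
  obj :: "'o set"
  arr :: "'o \<Rightarrow> 'o \<Rightarrow> 'm set"
  ident :: "'o \<Rightarrow> 'm"
  comp :: "'o \<Rightarrow> 'o \<Rightarrow> 'o \<Rightarrow> 'm \<Rightarrow> 'm \<Rightarrow> 'm"

locale category =
  fixes C :: "('o, 'm) category"
  assumes ident_arr: "X \<in> obj C \<Longrightarrow> ident C X \<in> arr C X X"
    and comp_arr:
      "\<lbrakk>X \<in> obj C; Y \<in> obj C; Z \<in> obj C; f \<in> arr C X Y; g \<in> arr C Y Z\<rbrakk>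
        \<Longrightarrow> comp C X Y Z g f \<in> arr C X Z"
    and comp_ident_right:
      "\<lbrakk>X \<in> obj C; Y \<in> obj C; f \<in> arr C X Y\<rbrakk> \<Longrightarrow> comp C X X Y f (ident C X) = f"
    and comp_ident_left:
      "\<lbrakk>X \<in> obj C; Y \<in> obj C; f \<in> arr C X Y\<rbrakk> \<Longrightarrow> comp C X Y Y (ident C Y) f = f"
    and comp_assoc:
      "\<lbrakk>W \<in> obj C; X \<in> obj C; Y \<in> obj C; Z \<in> obj C;
        f \<in> arr C W X; g \<in> arr C X Y; h \<in> arr C Y Z\<rbrakk>
        \<Longrightarrow> comp C W Y Z h (comp C W X Y g f) = comp C W X Z (comp C X Y Z h g) f"

definition iso_arrows :: "('o, 'm) category \<Rightarrow> 'o \<Rightarrow> 'o \<Rightarrow> 'm set" where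
  "iso_arrows C X Y = {f \<in> arr C X Y. \<exists>g \<in> arr C Y X.
     comp C X Y X g f = ident C X \<and> comp C Y X Y f g = ident C Y}"

record ('o, 'm, 'p, 'n) cat_functor =
  on_obj :: "'o \<Rightarrow> 'p"
  on_arr :: "'o \<Rightarrow> 'o \<Rightarrow> 'm \<Rightarrow> 'n"

locale cat_functor = source: category C + target: category D
  for C :: "('o, 'm) category" and D :: "('p, 'n) category" +
  fixes F :: "('o, 'm, 'p, 'n) cat_functor"
  assumes on_obj_closed: "X \<in> obj C \<Longrightarrow> on_obj F X \<in> obj D"
    and on_arr_closed:
      "\<lbrakk>X \<in> obj C; Y \<in> obj C; f \<in> arr C X Y\<rbrakk>
        \<Longrightarrow> on_arr F X Y f \<in> arr D (on_obj F X) (on_obj F Y)"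
    and on_arr_ident: "X \<in> obj C \<Longrightarrow> on_arr F X X (ident C X) = ident D (on_obj F X)"
    and on_arr_comp:
      "\<lbrakk>X \<in> obj C; Y \<in> obj C; Z \<in> obj C; f \<in> arr C X Y; g \<in> arr C Y Z\<rbrakk>
        \<Longrightarrow> on_arr F X Z (comp C X Y Z g f)
          = comp D (on_obj F X) (on_obj F Y) (on_obj F Z) (on_arr F Y Z g) (on_arr F X Y f)"

definition identity_functor :: "('o, 'm, 'o, 'm) cat_functor" where
  "identity_functor = \<lparr>on_obj = (\<lambda>X. X), on_arr = (\<lambda>X Y f. f)\<rparr>"

definition compose_functor ::
  "('p, 'n, 'q, 'l) cat_functor \<Rightarrow> ('o, 'm, 'p, 'n) cat_functor \<Rightarrow> ('o, 'm, 'q, 'l) cat_functor"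
where
  "compose_functor G F = \<lparr>on_obj = (\<lambda>X. on_obj G (on_obj F X)),
     on_arr = (\<lambda>X Y f. on_arr G (on_obj F X) (on_obj F Y) (on_arr F X Y f))\<rparr>"

definition naturally_isomorphic ::
  "('o, 'm) category \<Rightarrow> ('p, 'n) category
    \<Rightarrow> ('o, 'm, 'p, 'n) cat_functor \<Rightarrow> ('o, 'm, 'p, 'n) cat_functor \<Rightarrow> bool"
where
  "naturally_isomorphic C D F G \<longleftrightarrow>
    (\<exists>\<eta>. (\<forall>X \<in> obj C. \<eta> X \<in> iso_arrows D (on_obj F X) (on_obj G X)) \<and>
      (\<forall>X \<in> obj C. \<forall>Y \<in> obj C. \<forall>f \<in> arr C X Y.
        comp D (on_obj F X) (on_obj F Y) (on_obj G Y) (\<eta> Y) (on_arr F X Y f)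
        = comp D (on_obj F X) (on_obj G X) (on_obj G Y) (on_arr G X Y f) (\<eta> X)))"

text \<open>\<^term>\<open>cat_functor C D F\<close> includes that \<open>C\<close> and \<open>D\<close> satisfy the category axioms.\<close>

definition equivalent_categories :: "('o, 'm) category \<Rightarrow> ('p, 'n) category \<Rightarrow> bool" where
  "equivalent_categories C D \<longleftrightarrow>
    (\<exists>F G. cat_functor C D F \<and> cat_functor D C G \<and>
      naturally_isomorphic C C identity_functor (compose_functor G F) \<and>
      naturally_isomorphic D D (compose_functor F G) identity_functor)"


section \<open>Left modules\<close>

text \<open>\<^locale>\<open>module\<close> requires a commutative ring of scalars, so left modules over an arbitrary
  ring are introduced separately, on the same record type. The multiplication and the unit of
  the record \<open>M\<close> play no role.\<close>

locale left_module = R?: ring R + M?: abelian_group M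
  for R (structure) and M (structure) +
  assumes smult_closed:
      "\<lbrakk>a \<in> carrier R; x \<in> carrier M\<rbrakk> \<Longrightarrow> a \<odot>\<^bsub>M\<^esub> x \<in> carrier M"
    and smult_l_distr:
      "\<lbrakk>a \<in> carrier R; b \<in> carrier R; x \<in> carrier M\<rbrakk>
        \<Longrightarrow> (a \<oplus>\<^bsub>R\<^esub> b) \<odot>\<^bsub>M\<^esub> x = a \<odot>\<^bsub>M\<^esub> x \<oplus>\<^bsub>M\<^esub> b \<odot>\<^bsub>M\<^esub> x"
    and smult_r_distr:
      "\<lbrakk>a \<in> carrier R; x \<in> carrier M; y \<in> carrier M\<rbrakk>
        \<Longrightarrow> a \<odot>\<^bsub>M\<^esub> (x \<oplus>\<^bsub>M\<^esub> y) = a \<odot>\<^bsub>M\<^esub> x \<oplus>\<^bsub>M\<^esub> a \<odot>\<^bsub>M\<^esub> y"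
    and smult_assoc:
      "\<lbrakk>a \<in> carrier R; b \<in> carrier R; x \<in> carrier M\<rbrakk>
        \<Longrightarrow> (a \<otimes>\<^bsub>R\<^esub> b) \<odot>\<^bsub>M\<^esub> x = a \<odot>\<^bsub>M\<^esub> (b \<odot>\<^bsub>M\<^esub> x)"
    and smult_one: "x \<in> carrier M \<Longrightarrow> \<one>\<^bsub>R\<^esub> \<odot>\<^bsub>M\<^esub> x = x"

text \<open>Maps between carriers are taken extensional, so that equality of functions is equality
  on the carrier.\<close>

definition linear_maps ::
  "('r, 'c) ring_scheme \<Rightarrow> ('r, 'v) module \<Rightarrow> ('r, 'v) module \<Rightarrow> ('v \<Rightarrow> 'v) set"
where
  "linear_maps R V W = {f \<in> carrier V \<rightarrow>\<^sub>E carrier W.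
     (\<forall>x \<in> carrier V. \<forall>y \<in> carrier V. f (x \<oplus>\<^bsub>V\<^esub> y) = f x \<oplus>\<^bsub>W\<^esub> f y) \<and>
     (\<forall>a \<in> carrier R. \<forall>x \<in> carrier V. f (a \<odot>\<^bsub>V\<^esub> x) = a \<odot>\<^bsub>W\<^esub> f x)}"

definition linear_auts :: "('r, 'c) ring_scheme \<Rightarrow> ('r, 'v) module \<Rightarrow> ('v \<Rightarrow> 'v) set" where
  "linear_auts R V = {f \<in> linear_maps R V V. bij_betw f (carrier V) (carrier V)}"

text \<open>As HOL has no type of all sets, the categories of modules and of representations are
  relative to a type \<open>'v\<close>: their objects are the structures whose carrier is a subset of
  \<open>'v\<close>.\<close>

definition left_module_category ::
  "('r, 'c) ring_scheme \<Rightarrow> (('r, 'v) module, 'v \<Rightarrow> 'v) category"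
where
  "left_module_category R =
    \<lparr>obj = {M. left_module R M},
     arr = linear_maps R,
     ident = (\<lambda>M. \<lambda>x \<in> carrier M. x),
     comp = (\<lambda>M N P g f. compose (carrier M) g f)\<rparr>"


section \<open>Generalized digroups and their representations\<close>

record 'd digroup = "'d partial_object" +
  rprod :: "'d \<Rightarrow> 'd \<Rightarrow> 'd" (infixl \<open>\<turnstile>\<index>\<close> 70)
  lprod :: "'d \<Rightarrow> 'd \<Rightarrow> 'd" (infixl \<open>\<stileturn>\<index>\<close> 70)
  halo :: "'d set"

locale generalized_digroup =
  fixes D :: "'d digroup" (structure)
  assumes nonempty: "carrier D \<noteq> {}"
    and rprod_closed: "\<lbrakk>x \<in> carrier D; y \<in> carrier D\<rbrakk> \<Longrightarrow> x \<turnstile> y \<in> carrier D"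
    and lprod_closed: "\<lbrakk>x \<in> carrier D; y \<in> carrier D\<rbrakk> \<Longrightarrow> x \<stileturn> y \<in> carrier D"
    and rprod_assoc:
      "\<lbrakk>x \<in> carrier D; y \<in> carrier D; z \<in> carrier D\<rbrakk> \<Longrightarrow> (x \<turnstile> y) \<turnstile> z = x \<turnstile> (y \<turnstile> z)"
    and lprod_assoc:
      "\<lbrakk>x \<in> carrier D; y \<in> carrier D; z \<in> carrier D\<rbrakk> \<Longrightarrow> (x \<stileturn> y) \<stileturn> z = x \<stileturn> (y \<stileturn> z)"
    and halo_subset: "halo D \<subseteq> carrier D"
    and halo_nonempty: "halo D \<noteq> {}"
    and lprod_unit: "\<lbrakk>e \<in> halo D; x \<in> carrier D\<rbrakk> \<Longrightarrow> x \<stileturn> e = x"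
    and rprod_unit: "\<lbrakk>e \<in> halo D; x \<in> carrier D\<rbrakk> \<Longrightarrow> e \<turnstile> x = x"
    and left_inverse: "\<lbrakk>e \<in> halo D; x \<in> carrier D\<rbrakk> \<Longrightarrow> \<exists>y \<in> carrier D. y \<stileturn> x = e"
    and right_inverse: "\<lbrakk>e \<in> halo D; x \<in> carrier D\<rbrakk> \<Longrightarrow> \<exists>y \<in> carrier D. x \<turnstile> y = e"
    and rprod_lprod:
      "\<lbrakk>x \<in> carrier D; y \<in> carrier D; z \<in> carrier D\<rbrakk> \<Longrightarrow> x \<turnstile> (y \<stileturn> z) = (x \<turnstile> y) \<stileturn> z"
    and lprod_lprod:
      "\<lbrakk>x \<in> carrier D; y \<in> carrier D; z \<in> carrier D\<rbrakk> \<Longrightarrow> x \<stileturn> (y \<stileturn> z) = x \<stileturn> (y \<turnstile> z)"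
    and rprod_rprod:
      "\<lbrakk>x \<in> carrier D; y \<in> carrier D; z \<in> carrier D\<rbrakk> \<Longrightarrow> (x \<turnstile> y) \<turnstile> z = (x \<stileturn> y) \<turnstile> z"

locale representation =
  scalars: field K + digroup: generalized_digroup D + vectors: module K V
  for K :: "('k, 'c) ring_scheme" and D :: "'d digroup" and V :: "('k, 'v) module" +
  fixes lam rho :: "'d \<Rightarrow> 'v \<Rightarrow> 'v"
  assumes lam_End: "lam \<in> carrier D \<rightarrow> linear_maps K V V"
    and rho_Aut: "rho \<in> carrier D \<rightarrow> linear_auts K V"
    and lam_lprod:
      "\<lbrakk>x \<in> carrier D; y \<in> carrier D\<rbrakk>
        \<Longrightarrow> lam (x \<stileturn>\<^bsub>D\<^esub> y) = compose (carrier V) (lam x) (lam y)"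
    and rho_rprod:
      "\<lbrakk>x \<in> carrier D; y \<in> carrier D\<rbrakk>
        \<Longrightarrow> rho (x \<turnstile>\<^bsub>D\<^esub> y) = compose (carrier V) (rho x) (rho y)"
    and rho_unit: "e \<in> halo D \<Longrightarrow> rho e = (\<lambda>v \<in> carrier V. v)"
    and rho_lam:
      "\<lbrakk>x \<in> carrier D; y \<in> carrier D\<rbrakk>
        \<Longrightarrow> compose (carrier V) (rho x) (lam y) = lam (x \<turnstile>\<^bsub>D\<^esub> y)"
    and lam_rho:
      "\<lbrakk>x \<in> carrier D; y \<in> carrier D\<rbrakk>
        \<Longrightarrow> compose (carrier V) (lam x) (rho y) = lam (x \<stileturn>\<^bsub>D\<^esub> y)"

type_synonym ('k, 'd, 'v) rep = "('k, 'v) module \<times> ('d \<Rightarrow> 'v \<Rightarrow> 'v) \<times> ('d \<Rightarrow> 'v \<Rightarrow> 'v)"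

definition rep_morphisms ::
  "('k, 'c) ring_scheme \<Rightarrow> 'd digroup \<Rightarrow> ('k, 'd, 'v) rep \<Rightarrow> ('k, 'd, 'v) rep \<Rightarrow> ('v \<Rightarrow> 'v) set"
where
  "rep_morphisms K D = (\<lambda>(V, lam, rho) (W, lam', rho').
     {f \<in> linear_maps K V W. \<forall>x \<in> carrier D.
        compose (carrier V) f (lam x) = compose (carrier V) (lam' x) f \<and>
        compose (carrier V) f (rho x) = compose (carrier V) (rho' x) f})"

definition rep_category ::
  "('k, 'c) ring_scheme \<Rightarrow> 'd digroup \<Rightarrow> (('k, 'd, 'v) rep, 'v \<Rightarrow> 'v) category"
where
  "rep_category K D =
    \<lparr>obj = {(V, lam, rho). representation K D V lam rho},
     arr = rep_morphisms K D,
     ident = (\<lambda>(V, lam, rho). \<lambda>v \<in> carrier V. v),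
     comp = (\<lambda>(V, lam, rho) Y Z g f. compose (carrier V) g f)\<rparr>"


section \<open>The enveloping algebra\<close>

text \<open>The free unital associative algebra on a set \<open>X\<close> consists of the finitely supported
  functions from words over \<open>X\<close> to the scalars. The product is convolution over the
  factorizations of a word into two factors, each of which is a cut at some position.\<close>

definition free_algebra :: "('k, 'c) ring_scheme \<Rightarrow> 'x set \<Rightarrow> ('k, 'x list \<Rightarrow> 'k) module" where
  "free_algebra K X =
    \<lparr>carrier = {f. (\<forall>w. f w \<in> carrier K) \<and> finite {w. f w \<noteq> \<zero>\<^bsub>K\<^esub>} \<and>
        {w. f w \<noteq> \<zero>\<^bsub>K\<^esub>} \<subseteq> lists X},
     mult = (\<lambda>f g w. \<Oplus>\<^bsub>K\<^esub>i \<in> {..length w}. f (take i w) \<otimes>\<^bsub>K\<^esub> g (drop i w)),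
     one = (\<lambda>w. if w = [] then \<one>\<^bsub>K\<^esub> else \<zero>\<^bsub>K\<^esub>),
     zero = (\<lambda>w. \<zero>\<^bsub>K\<^esub>),
     add = (\<lambda>f g w. f w \<oplus>\<^bsub>K\<^esub> g w),
     smult = (\<lambda>a f w. a \<otimes>\<^bsub>K\<^esub> f w)\<rparr>"

definition free_gen :: "('k, 'c) ring_scheme \<Rightarrow> 'x \<Rightarrow> 'x list \<Rightarrow> 'k" where
  "free_gen K x = (\<lambda>w. if w = [x] then \<one>\<^bsub>K\<^esub> else \<zero>\<^bsub>K\<^esub>)"

text \<open>The quotient by a two-sided ideal as an algebra: \<open>F Quot I\<close> extended by the induced
  scalar multiplication of cosets.\<close>

definition quotient_algebra :: "('k, 'a) module \<Rightarrow> 'a set \<Rightarrow> ('k, 'a set) module" where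
  "quotient_algebra F I =
    ring.extend (F Quot I) (module.fields (\<lambda>a X. \<Union>f \<in> X. I +>\<^bsub>F\<^esub> (a \<odot>\<^bsub>F\<^esub> f)))"

datatype 'd symbol = L 'd | R 'd

definition env_free_algebra ::
  "('k, 'c) ring_scheme \<Rightarrow> 'd digroup \<Rightarrow> ('k, 'd symbol list \<Rightarrow> 'k) module"
where
  "env_free_algebra K D = free_algebra K (L ` carrier D \<union> R ` carrier D)"

definition env_relators ::
  "('k, 'c) ring_scheme \<Rightarrow> 'd digroup \<Rightarrow> ('d symbol list \<Rightarrow> 'k) set"
where
  "env_relators K D =
    (let F = env_free_algebra K D; l = (\<lambda>x. free_gen K (L x)); r = (\<lambda>x. free_gen K (R x)) in
      {l (x \<stileturn>\<^bsub>D\<^esub> y) \<ominus>\<^bsub>F\<^esub> (l x \<otimes>\<^bsub>F\<^esub> l y) | x y. x \<in> carrier D \<and> y \<in> carrier D} \<union>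
      {r (x \<turnstile>\<^bsub>D\<^esub> y) \<ominus>\<^bsub>F\<^esub> (r x \<otimes>\<^bsub>F\<^esub> r y) | x y. x \<in> carrier D \<and> y \<in> carrier D} \<union>
      {r e \<ominus>\<^bsub>F\<^esub> \<one>\<^bsub>F\<^esub> | e. e \<in> halo D} \<union>
      {(r x \<otimes>\<^bsub>F\<^esub> l y) \<ominus>\<^bsub>F\<^esub> l (x \<turnstile>\<^bsub>D\<^esub> y) | x y. x \<in> carrier D \<and> y \<in> carrier D} \<union>
      {(l x \<otimes>\<^bsub>F\<^esub> r y) \<ominus>\<^bsub>F\<^esub> l (x \<stileturn>\<^bsub>D\<^esub> y) | x y. x \<in> carrier D \<and> y \<in> carrier D})"

text \<open>In HOL-Algebra \<^locale>\<open>ideal\<close> means two-sided ideal. Since the algebra is unital, a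
  two-sided ring ideal is closed under scalar multiplication.\<close>

definition enveloping_algebra ::
  "('k, 'c) ring_scheme \<Rightarrow> 'd digroup \<Rightarrow> ('k, ('d symbol list \<Rightarrow> 'k) set) module"
where
  "enveloping_algebra K D =
    quotient_algebra (env_free_algebra K D)
      (genideal (env_free_algebra K D) (env_relators K D))"

end

theory Submission
  imports Defs
begin

text \<open>The five laws of a representation say exactly that the assignment \<open>L x \<mapsto> \<lambda>\<^sub>x\<close>,
  \<open>R x \<mapsto> \<rho>\<^sub>x\<close> respects the defining relations of the enveloping algebra. By the universal property
  of the free algebra (\<open>free_algebra_lifting.lift_ring_hom\<close>) the assignment extends to a ring
  homomorphism from the free algebra to the endomorphism ring of the representation space, and
  its kernel is an ideal that contains the relators, so the homomorphism descends to the
  quotient (\<open>env_descent\<close>). This makes the representation space a left module over the enveloping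
  algebra.

  Conversely, a left module over the enveloping algebra becomes a vector space through the
  scalars of the algebra, and the classes of \<open>L x\<close> and \<open>R x\<close> act linearly because these scalars
  are central. The one condition which is not a relation is that each \<open>\<rho>\<^sub>x\<close> is invertible. It is
  automatic: a right inverse of \<open>x\<close> for \<open>\<turnstile>\<close> gives a right inverse of the action of \<open>R x\<close>, since the
  class of \<open>R e\<close> is \<open>1\<close> for a bar-unit \<open>e\<close>; this right inverse has itself a right inverse, and so
  is a two-sided one (\<open>R_class_bij\<close>).

  Both constructions keep the underlying set and its addition, and both functors keep the
  functions that are the arrows. This is possible because the scalars and the generators generate
  the free algebra (\<open>generator_induct\<close>): a linear map that commutes with all \<open>\<lambda>\<^sub>x\<close> and \<open>\<rho>\<^sub>x\<close>
  commutes with the whole enveloping algebra, and a module structure is determined by the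
  representation that it induces. Either composite of the functors thus returns an object with
  the same operations on the same carrier, and the identity functions of the carriers are the
  natural isomorphisms. The objects themselves need not be equal, since the composites change the
  values of the operations at arguments outside the carriers, and these values are arbitrary.\<close>

section \<open>The free algebra as a ring\<close>

definition monomial :: "('k, 'c) ring_scheme \<Rightarrow> 'k \<Rightarrow> 'x list \<Rightarrow> 'x list \<Rightarrow> 'k" where
  "monomial K a w = (\<lambda>u. if u = w then a else \<zero>\<^bsub>K\<^esub>)"

locale free_algebra_setting = cring K
  for K :: "('k, 'c) ring_scheme" (structure) and X :: "'x set"
begin

abbreviation F :: "('k, 'x list \<Rightarrow> 'k) module" where
  "F \<equiv> free_algebra K X"

lemma carrier_iff:
  "f \<in> carrier F \<longleftrightarrow>
     (\<forall>w. f w \<in> carrier K) \<and> finite {w. f w \<noteq> \<zero>} \<and> {w. f w \<noteq> \<zero>} \<subseteq> lists X"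
  by (simp add: free_algebra_def)

lemma add_apply: "(f \<oplus>\<^bsub>F\<^esub> g) w = f w \<oplus> g w"
  and zero_apply: "\<zero>\<^bsub>F\<^esub> w = \<zero>"
  and smult_apply: "(a \<odot>\<^bsub>F\<^esub> f) w = a \<otimes> f w"
  and mult_apply: "(f \<otimes>\<^bsub>F\<^esub> g) w = (\<Oplus>i \<in> {..length w}. f (take i w) \<otimes> g (drop i w))"
  by (simp_all add: free_algebra_def)

lemma one_eq_monomial: "\<one>\<^bsub>F\<^esub> = monomial K \<one> []"
  and free_gen_eq_monomial: "free_gen K x = monomial K \<one> [x]"
  by (simp_all add: free_algebra_def free_gen_def monomial_def)

lemma coeff_closed: "f \<in> carrier F \<Longrightarrow> f w \<in> carrier K"
  by (simp add: carrier_iff)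

lemma mult_apply_Nil:
  assumes "f \<in> UNIV \<rightarrow> carrier K" and "g \<in> UNIV \<rightarrow> carrier K"
  shows "(f \<otimes>\<^bsub>F\<^esub> g) [] = f [] \<otimes> g []"
  using assms by (simp add: mult_apply Pi_iff)

text \<open>The first part of a cut of \<open>x # w\<close> is either empty or begins with \<open>x\<close>. Together with
  \<open>mult_apply_Nil\<close>, this recursion turns statements about convolutions into inductions on
  words.\<close>

lemma mult_apply_Cons:
  assumes "f \<in> UNIV \<rightarrow> carrier K" and "g \<in> UNIV \<rightarrow> carrier K"
  shows "(f \<otimes>\<^bsub>F\<^esub> g) (x # w) = ((\<lambda>u. f (x # u)) \<otimes>\<^bsub>F\<^esub> g) w \<oplus> f [] \<otimes> g (x # w)"
  unfolding mult_apply length_Cons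
  by (subst finsum_Suc2) (use assms in \<open>auto simp: Pi_iff\<close>)

lemma mult_apply_closed:
  assumes "f \<in> UNIV \<rightarrow> carrier K" and "g \<in> UNIV \<rightarrow> carrier K"
  shows "(f \<otimes>\<^bsub>F\<^esub> g) w \<in> carrier K"
  unfolding mult_apply by (rule finsum_closed) (use assms in \<open>auto simp: Pi_iff\<close>)

lemma mult_linear_left:
  assumes "c \<in> carrier K" "f \<in> UNIV \<rightarrow> carrier K" "g \<in> UNIV \<rightarrow> carrier K"
    "h \<in> UNIV \<rightarrow> carrier K"
  shows "((\<lambda>u. f u \<oplus> c \<otimes> g u) \<otimes>\<^bsub>F\<^esub> h) w = (f \<otimes>\<^bsub>F\<^esub> h) w \<oplus> c \<otimes> (g \<otimes>\<^bsub>F\<^esub> h) w"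
proof -
  have "((\<lambda>u. f u \<oplus> c \<otimes> g u) \<otimes>\<^bsub>F\<^esub> h) w =
      (\<Oplus>i \<in> {..length w}. f (take i w) \<otimes> h (drop i w) \<oplus> c \<otimes> (g (take i w) \<otimes> h (drop i w)))"
    unfolding mult_apply
    by (rule finsum_cong') (use assms in \<open>auto simp: Pi_iff l_distr m_assoc\<close>)
  then show ?thesis
    unfolding mult_apply using assms by (simp add: finsum_addf finsum_rdistr Pi_iff)
qed

text \<open>Removing the first letter from \<open>f g\<close> gives a sum of a product and a multiple of a coefficient
  function, so by \<open>mult_linear_left\<close> the induction hypothesis applies to the left factor with its
  first letter removed. This avoids reindexing a double sum over pairs of cuts.\<close>

lemma mult_apply_assoc:
  assumes "f \<in> UNIV \<rightarrow> carrier K" "g \<in> UNIV \<rightarrow> carrier K" "h \<in> UNIV \<rightarrow> carrier K"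
  shows "((f \<otimes>\<^bsub>F\<^esub> g) \<otimes>\<^bsub>F\<^esub> h) w = (f \<otimes>\<^bsub>F\<^esub> (g \<otimes>\<^bsub>F\<^esub> h)) w"
  using assms(1)
proof (induction w arbitrary: f)
  case Nil
  with assms show ?case
    by (simp add: mult_apply_Nil mult_apply_closed Pi_iff m_assoc)
next
  case (Cons x w)
  let ?f = "\<lambda>u. f (x # u)" and ?g = "\<lambda>u. g (x # u)"
  have f: "f [] \<in> carrier K" "?f \<in> UNIV \<rightarrow> carrier K" and g: "?g \<in> UNIV \<rightarrow> carrier K"
    using Cons.prems assms by auto
  have fg: "f \<otimes>\<^bsub>F\<^esub> g \<in> UNIV \<rightarrow> carrier K" "?f \<otimes>\<^bsub>F\<^esub> g \<in> UNIV \<rightarrow> carrier K" "g \<otimes>\<^bsub>F\<^esub> h \<in> UNIV \<rightarrow> carrier K"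
    using Cons.prems assms f by (auto intro: mult_apply_closed)
  have "(\<lambda>u. (f \<otimes>\<^bsub>F\<^esub> g) (x # u)) = (\<lambda>u. (?f \<otimes>\<^bsub>F\<^esub> g) u \<oplus> f [] \<otimes> ?g u)"
    using Cons.prems assms by (simp add: mult_apply_Cons)
  then have "((f \<otimes>\<^bsub>F\<^esub> g) \<otimes>\<^bsub>F\<^esub> h) (x # w)
    = (((?f \<otimes>\<^bsub>F\<^esub> g) \<otimes>\<^bsub>F\<^esub> h) w \<oplus> f [] \<otimes> (?g \<otimes>\<^bsub>F\<^esub> h) w) \<oplus> (f [] \<otimes> g []) \<otimes> h (x # w)"
    using assms Cons.prems f g fg by (simp add: mult_apply_Cons mult_linear_left mult_apply_Nil)
  also have "\<dots> = (?f \<otimes>\<^bsub>F\<^esub> (g \<otimes>\<^bsub>F\<^esub> h)) w \<oplus> f [] \<otimes> ((?g \<otimes>\<^bsub>F\<^esub> h) w \<oplus> g [] \<otimes> h (x # w))"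
    using assms f g fg
    by (simp add: Cons.IH mult_apply_closed Pi_iff r_distr m_assoc a_assoc)
  also have "\<dots> = (f \<otimes>\<^bsub>F\<^esub> (g \<otimes>\<^bsub>F\<^esub> h)) (x # w)"
    using assms Cons.prems fg by (simp add: mult_apply_Cons)
  finally show ?case .
qed

lemma carrier_fun: "f \<in> carrier F \<Longrightarrow> f \<in> UNIV \<rightarrow> carrier K"
  by (simp add: carrier_iff)

lemma monomial_closed: "a \<in> carrier K \<Longrightarrow> w \<in> lists X \<Longrightarrow> monomial K a w \<in> carrier F"
  by (auto simp: carrier_iff monomial_def)

lemma add_closed: 
  assumes "f \<in> carrier F" "g \<in> carrier F" shows "f \<oplus>\<^bsub>F\<^esub> g \<in> carrier F"
proof -
  have "{w. f w \<oplus> g w \<noteq> \<zero>} \<subseteq> {w. f w \<noteq> \<zero>} \<union> {w. g w \<noteq> \<zero>}"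
    by auto
  moreover have "finite ({w. f w \<noteq> \<zero>} \<union> {w. g w \<noteq> \<zero>})"
    "{w. f w \<noteq> \<zero>} \<union> {w. g w \<noteq> \<zero>} \<subseteq> lists X"
    using assms unfolding carrier_iff by blast+
  ultimately have "finite {w. f w \<oplus> g w \<noteq> \<zero>}" "{w. f w \<oplus> g w \<noteq> \<zero>} \<subseteq> lists X"
    by (blast intro: finite_subset)+
  then show ?thesis
    using assms by (simp add: carrier_iff add_apply)
qed

lemma smult_closed:
  assumes "a \<in> carrier K" "f \<in> carrier F" shows "a \<odot>\<^bsub>F\<^esub> f \<in> carrier F"
proof -
  have "{w. a \<otimes> f w \<noteq> \<zero>} \<subseteq> {w. f w \<noteq> \<zero>}"
    using assms(1) by auto
  moreover have "finite {w. f w \<noteq> \<zero>}" "{w. f w \<noteq> \<zero>} \<subseteq> lists X"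
    using assms unfolding carrier_iff by blast+
  ultimately have "finite {w. a \<otimes> f w \<noteq> \<zero>}" "{w. a \<otimes> f w \<noteq> \<zero>} \<subseteq> lists X"
    by (blast intro: finite_subset)+
  then show ?thesis
    using assms by (simp add: carrier_iff smult_apply)
qed

lemma mult_closed:
  assumes "f \<in> carrier F" "g \<in> carrier F" shows "f \<otimes>\<^bsub>F\<^esub> g \<in> carrier F"
proof -
  have "\<exists>u v. w = u @ v \<and> f u \<noteq> \<zero> \<and> g v \<noteq> \<zero>" if "(f \<otimes>\<^bsub>F\<^esub> g) w \<noteq> \<zero>" for w
  proof (rule ccontr)
    assume none: "\<not> ?thesis"
    have "f (take i w) \<otimes> g (drop i w) = \<zero>" for i
    proof -
      have "f (take i w) = \<zero> \<or> g (drop i w) = \<zero>"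
        using none by (metis append_take_drop_id)
      then show ?thesis
        using assms by (auto simp: coeff_closed)
    qed
    then have "(f \<otimes>\<^bsub>F\<^esub> g) w = \<zero>"
      by (simp add: mult_apply)
    with that show False ..
  qed
  then have sub: "{w. (f \<otimes>\<^bsub>F\<^esub> g) w \<noteq> \<zero>} \<subseteq> (\<lambda>(u, v). u @ v) ` ({u. f u \<noteq> \<zero>} \<times> {v. g v \<noteq> \<zero>})"
    by fastforce
  have "finite {u. f u \<noteq> \<zero>}" "finite {v. g v \<noteq> \<zero>}" "{u. f u \<noteq> \<zero>} \<subseteq> lists X" "{v. g v \<noteq> \<zero>} \<subseteq> lists X"
    using assms by (simp_all add: carrier_iff)
  then have "finite ((\<lambda>(u, v). u @ v) ` ({u. f u \<noteq> \<zero>} \<times> {v. g v \<noteq> \<zero>}))"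
    "(\<lambda>(u, v). u @ v) ` ({u. f u \<noteq> \<zero>} \<times> {v. g v \<noteq> \<zero>}) \<subseteq> lists X"
    by (blast, fastforce simp del: in_lists_conv_set simp: append_in_lists_conv)
  with sub have "finite {w. (f \<otimes>\<^bsub>F\<^esub> g) w \<noteq> \<zero>}" "{w. (f \<otimes>\<^bsub>F\<^esub> g) w \<noteq> \<zero>} \<subseteq> lists X"
    by (blast intro: finite_subset)+
  then show ?thesis
    using assms by (simp add: carrier_iff mult_apply_closed)
qed

lemma mult_one_left: "f \<in> carrier F \<Longrightarrow> \<one>\<^bsub>F\<^esub> \<otimes>\<^bsub>F\<^esub> f = f"
proof
  fix w assume f: "f \<in> carrier F"
  have "(\<one>\<^bsub>F\<^esub> \<otimes>\<^bsub>F\<^esub> f) w = (\<Oplus>i \<in> {..length w}. if i = 0 then f w else \<zero>)"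
    unfolding mult_apply one_eq_monomial monomial_def
    by (rule finsum_cong') (use f in \<open>auto simp: coeff_closed\<close>)
  also have "\<dots> = f w"
    using finsum_singleton[of 0 "{..length w}" "\<lambda>_. f w"] f by (auto simp: coeff_closed)
  finally show "(\<one>\<^bsub>F\<^esub> \<otimes>\<^bsub>F\<^esub> f) w = f w" .
qed

lemma monomial_mult:
  assumes "a \<in> carrier K" "b \<in> carrier K"
  shows "monomial K a u \<otimes>\<^bsub>F\<^esub> monomial K b v = monomial K (a \<otimes> b) (u @ v)"
proof
  fix w
  have "(monomial K a u \<otimes>\<^bsub>F\<^esub> monomial K b v) w
      = (\<Oplus>i \<in> {..length w}. if length u = i then (if w = u @ v then a \<otimes> b else \<zero>) else \<zero>)"
    unfolding mult_apply
  proof (rule finsum_cong')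
    fix i assume i: "i \<in> {..length w}"
    have cut: "take i w = u \<and> drop i w = v \<longleftrightarrow> length u = i \<and> w = u @ v"
      using i by (auto simp: append_eq_conv_conj min_def)
    have "monomial K a u (take i w) \<otimes> monomial K b v (drop i w)
        = (if take i w = u \<and> drop i w = v then a \<otimes> b else \<zero>)"
      using assms by (simp add: monomial_def)
    also have "\<dots> = (if length u = i then (if w = u @ v then a \<otimes> b else \<zero>) else \<zero>)"
      by (simp only: cut) simp
    finally show "monomial K a u (take i w) \<otimes> monomial K b v (drop i w)
        = (if length u = i then (if w = u @ v then a \<otimes> b else \<zero>) else \<zero>)" .
  qed (use assms in auto)
  also have "\<dots> = monomial K (a \<otimes> b) (u @ v) w"
  proof (cases "w = u @ v")
    case True
    with assms finsum_singleton[of "length u" "{..length w}" "\<lambda>_. a \<otimes> b"] show ?thesis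
      by (auto simp: monomial_def)
  next
    case False
    then show ?thesis by (simp add: monomial_def)
  qed
  finally show "(monomial K a u \<otimes>\<^bsub>F\<^esub> monomial K b v) w = monomial K (a \<otimes> b) (u @ v) w" .
qed

lemma mult_one_right: "f \<in> carrier F \<Longrightarrow> f \<otimes>\<^bsub>F\<^esub> \<one>\<^bsub>F\<^esub> = f"
proof
  fix w assume f: "f \<in> carrier F"
  have "(f \<otimes>\<^bsub>F\<^esub> \<one>\<^bsub>F\<^esub>) w = (\<Oplus>i \<in> {..length w}. if length w = i then f w else \<zero>)"
    unfolding mult_apply one_eq_monomial monomial_def
    by (rule finsum_cong') (use f in \<open>auto simp: coeff_closed\<close>)
  also have "\<dots> = f w"
    using finsum_singleton[of "length w" "{..length w}" "\<lambda>_. f w"] f by (auto simp: coeff_closed)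
  finally show "(f \<otimes>\<^bsub>F\<^esub> \<one>\<^bsub>F\<^esub>) w = f w" .
qed

lemma ring_free_algebra: "ring F"
proof (rule ringI)
  show "abelian_group F"
  proof (rule abelian_groupI)
    fix f assume f: "f \<in> carrier F"
    have "(\<ominus> \<one>) \<odot>\<^bsub>F\<^esub> f \<in> carrier F"
      by (rule smult_closed) (use f in auto)
    moreover have "(\<ominus> \<one>) \<odot>\<^bsub>F\<^esub> f \<oplus>\<^bsub>F\<^esub> f = \<zero>\<^bsub>F\<^esub>"
    proof
      fix w
      show "((\<ominus> \<one>) \<odot>\<^bsub>F\<^esub> f \<oplus>\<^bsub>F\<^esub> f) w = \<zero>\<^bsub>F\<^esub> w"
        using coeff_closed[OF f, of w] by (simp add: add_apply smult_apply zero_apply l_minus l_neg)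
    qed
    ultimately show "\<exists>g \<in> carrier F. g \<oplus>\<^bsub>F\<^esub> f = \<zero>\<^bsub>F\<^esub>"
      by blast
  qed (simp_all add: add_closed fun_eq_iff add_apply zero_apply coeff_closed a_assoc a_comm
        a_lcomm carrier_iff[of "\<zero>\<^bsub>F\<^esub>"])
  show "monoid F"
    by (rule monoidI)
      (simp_all add: mult_closed mult_one_left mult_one_right one_eq_monomial[symmetric]
        fun_eq_iff mult_apply_assoc carrier_fun,
       simp add: one_eq_monomial monomial_closed)
next
  fix f g h assume fgh: "f \<in> carrier F" "g \<in> carrier F" "h \<in> carrier F"
  show "(f \<oplus>\<^bsub>F\<^esub> g) \<otimes>\<^bsub>F\<^esub> h = f \<otimes>\<^bsub>F\<^esub> h \<oplus>\<^bsub>F\<^esub> g \<otimes>\<^bsub>F\<^esub> h"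
    using fgh by (simp add: fun_eq_iff add_apply mult_apply l_distr coeff_closed finsum_addf Pi_iff)
  show "h \<otimes>\<^bsub>F\<^esub> (f \<oplus>\<^bsub>F\<^esub> g) = h \<otimes>\<^bsub>F\<^esub> f \<oplus>\<^bsub>F\<^esub> h \<otimes>\<^bsub>F\<^esub> g"
    using fgh by (simp add: fun_eq_iff add_apply mult_apply r_distr coeff_closed finsum_addf Pi_iff)
qed

text \<open>An element of the free algebra is the sum of its finitely many monomials; the induction is on
  the size of the support.\<close>

lemma span_induct [consumes 1, case_names monomial add]:
  assumes "f \<in> carrier F"
    and mono: "\<And>a w. a \<in> carrier K \<Longrightarrow> w \<in> lists X \<Longrightarrow> P (monomial K a w)"
    and add: "\<And>f g. f \<in> carrier F \<Longrightarrow> g \<in> carrier F \<Longrightarrow> P f \<Longrightarrow> P g \<Longrightarrow> P (f \<oplus>\<^bsub>F\<^esub> g)"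
  shows "P f"
proof -
  have "finite S \<Longrightarrow> f \<in> carrier F \<Longrightarrow> {w. f w \<noteq> \<zero>} = S \<Longrightarrow> P f" for S
  proof (induction S arbitrary: f rule: finite_induct)
    case empty
    then have "f = monomial K \<zero> []"
      by (auto simp: monomial_def fun_eq_iff)
    then show ?case
      using mono[of \<zero> "[]"] by simp
  next
    case (insert v S)
    let ?g = "f(v := \<zero>)"
    have supp: "{w. ?g w \<noteq> \<zero>} = S"
      using insert.hyps(2) insert.prems(2) by auto
    have g: "?g \<in> carrier F"
      using insert.prems insert.hyps supp by (auto simp: carrier_iff)
    have v: "f v \<in> carrier K" "v \<in> lists X"
      using insert.prems by (auto simp: carrier_iff)
    \<comment> \<open>Peel the monomial of one word off the support.\<close>
    have "f = ?g \<oplus>\<^bsub>F\<^esub> monomial K (f v) v"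
      using insert.prems(1) by (auto simp: fun_eq_iff add_apply monomial_def coeff_closed)
    moreover have "P (?g \<oplus>\<^bsub>F\<^esub> monomial K (f v) v)"
      by (rule add[OF g monomial_closed[OF v] insert.IH[OF g supp] mono[OF v]])
    ultimately show ?case by simp
  qed
  with assms(1) show ?thesis
    by (auto simp: carrier_iff)
qed

lemma gen_closed: "x \<in> X \<Longrightarrow> free_gen K x \<in> carrier F"
  by (simp add: free_gen_eq_monomial monomial_closed)

text \<open>A monomial is a scalar times a product of generators, so the scalars and the generators
  generate the free algebra as a ring. Elements of the enveloping algebra are
  classes of such elements, so its actions are determined on scalars and generators.\<close>

lemma generator_induct [consumes 1, case_names scalar gen add mult]:
  assumes "f \<in> carrier F"
    and scalar: "\<And>a. a \<in> carrier K \<Longrightarrow> P (monomial K a [])"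
    and gen: "\<And>x. x \<in> X \<Longrightarrow> P (free_gen K x)"
    and add: "\<And>f g. f \<in> carrier F \<Longrightarrow> g \<in> carrier F \<Longrightarrow> P f \<Longrightarrow> P g \<Longrightarrow> P (f \<oplus>\<^bsub>F\<^esub> g)"
    and mult: "\<And>f g. f \<in> carrier F \<Longrightarrow> g \<in> carrier F \<Longrightarrow> P f \<Longrightarrow> P g \<Longrightarrow> P (f \<otimes>\<^bsub>F\<^esub> g)"
  shows "P f"
  using assms(1)
proof (induction rule: span_induct)
  case (monomial a w)
  from monomial(2) show ?case
  proof (induction w rule: rev_induct)
    case Nil
    then show ?case using scalar monomial(1) by simp
  next
    case (snoc x w)
    have "monomial K a (w @ [x]) = monomial K a w \<otimes>\<^bsub>F\<^esub> free_gen K x"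
      using monomial(1) by (simp add: free_gen_eq_monomial monomial_mult)
    moreover have "P (monomial K a w \<otimes>\<^bsub>F\<^esub> free_gen K x)"
      using snoc monomial(1) by (intro mult gen monomial_closed gen_closed) auto
    ultimately show ?case by simp
  qed
next
  case (add f g)
  then show ?case using assms(4) by blast
qed

lemma scalar_central:
  assumes "a \<in> carrier K" "f \<in> carrier F"
  shows "monomial K a [] \<otimes>\<^bsub>F\<^esub> f = f \<otimes>\<^bsub>F\<^esub> monomial K a []"
proof -
  interpret F: ring F by (rule ring_free_algebra)
  have a: "monomial K a [] \<in> carrier F"
    using assms by (simp add: monomial_closed)
  from assms(2) show ?thesis
    by (induction rule: span_induct)
      (use assms(1) a in \<open>simp_all add: monomial_mult m_comm F.l_distr F.r_distr\<close>)
qed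

lemma scalar_ring_hom: "(\<lambda>a. monomial K a []) \<in> ring_hom K F"
  by (rule ring_hom_memI)
    (simp_all add: monomial_closed monomial_mult one_eq_monomial,
     simp add: fun_eq_iff add_apply monomial_def)

end

section \<open>The universal property of the free algebra\<close>

definition word_product :: "('r, 'e) ring_scheme \<Rightarrow> ('x \<Rightarrow> 'r) \<Rightarrow> 'x list \<Rightarrow> 'r" where
  "word_product A \<theta> w = foldr (\<lambda>x y. \<theta> x \<otimes>\<^bsub>A\<^esub> y) w \<one>\<^bsub>A\<^esub>"

definition algebra_lift ::
  "('k, 'c) ring_scheme \<Rightarrow> ('r, 'e) ring_scheme \<Rightarrow> ('k \<Rightarrow> 'r) \<Rightarrow> ('x \<Rightarrow> 'r)
    \<Rightarrow> ('x list \<Rightarrow> 'k) \<Rightarrow> 'r" where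
  "algebra_lift K A \<phi> \<theta> f =
    (\<Oplus>\<^bsub>A\<^esub>w \<in> {w. f w \<noteq> \<zero>\<^bsub>K\<^esub>}. \<phi> (f w) \<otimes>\<^bsub>A\<^esub> word_product A \<theta> w)"

text \<open>The target is an algebra in the form of a ring with a homomorphism \<open>\<phi>\<close> from the scalars. The
  image of \<open>\<phi>\<close> has to commute only with the images of the generators, since all elements in the
  range of the lift are built from these and from scalars.\<close>

locale free_algebra_lifting = free_algebra_setting K X + A: ring A
  for K :: "('k, 'c) ring_scheme" (structure) and X :: "'x set"
    and A :: "('r, 'e) ring_scheme" (structure) +
  fixes \<phi> :: "'k \<Rightarrow> 'r" and \<theta> :: "'x \<Rightarrow> 'r"
  assumes scalar_hom: "\<phi> \<in> ring_hom K A"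
    and gen_image: "x \<in> X \<Longrightarrow> \<theta> x \<in> carrier A"
    and scalar_commute: "a \<in> carrier K \<Longrightarrow> x \<in> X \<Longrightarrow> \<phi> a \<otimes>\<^bsub>A\<^esub> \<theta> x = \<theta> x \<otimes>\<^bsub>A\<^esub> \<phi> a"
begin

abbreviation lift :: "('x list \<Rightarrow> 'k) \<Rightarrow> 'r" where
  "lift \<equiv> algebra_lift K A \<phi> \<theta>"

lemma scalar_closed: "a \<in> carrier K \<Longrightarrow> \<phi> a \<in> carrier A"
  using scalar_hom by (rule ring_hom_closed)

lemma scalar_zero: "\<phi> \<zero>\<^bsub>K\<^esub> = \<zero>\<^bsub>A\<^esub>"
  using ring_hom_zero[OF scalar_hom] A.ring_axioms ring_axioms by blast

lemma word_product_closed: "w \<in> lists X \<Longrightarrow> word_product A \<theta> w \<in> carrier A"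
  by (induction w) (auto simp: word_product_def gen_image)

lemma word_product_append:
  "u \<in> lists X \<Longrightarrow> v \<in> lists X \<Longrightarrow>
    word_product A \<theta> (u @ v) = word_product A \<theta> u \<otimes>\<^bsub>A\<^esub> word_product A \<theta> v"
proof (induction u)
  case Nil
  then show ?case
    using word_product_closed[of v] by (simp add: word_product_def)
next
  case (Cons x u)
  then have "word_product A \<theta> (x # u @ v) = \<theta> x \<otimes>\<^bsub>A\<^esub> (word_product A \<theta> u \<otimes>\<^bsub>A\<^esub> word_product A \<theta> v)"
    by (simp add: word_product_def)
  also have "\<dots> = word_product A \<theta> (x # u) \<otimes>\<^bsub>A\<^esub> word_product A \<theta> v"
    using Cons.prems word_product_closed[of u] word_product_closed[of v]
    by (simp add: word_product_def gen_image A.m_assoc)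
  finally show ?case by simp
qed

lemma scalar_word_commute:
  assumes "a \<in> carrier K"
  shows "w \<in> lists X \<Longrightarrow> \<phi> a \<otimes>\<^bsub>A\<^esub> word_product A \<theta> w = word_product A \<theta> w \<otimes>\<^bsub>A\<^esub> \<phi> a"
proof (induction w)
  case Nil
  then show ?case
    using assms by (simp add: word_product_def scalar_closed)
next
  case (Cons x w)
  then have c: "\<theta> x \<in> carrier A" "word_product A \<theta> w \<in> carrier A" "\<phi> a \<in> carrier A" and x: "x \<in> X"
    using assms by (auto simp: gen_image word_product_closed scalar_closed)
  have "\<phi> a \<otimes>\<^bsub>A\<^esub> word_product A \<theta> (x # w) = (\<phi> a \<otimes>\<^bsub>A\<^esub> \<theta> x) \<otimes>\<^bsub>A\<^esub> word_product A \<theta> w"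
    using c by (simp add: word_product_def A.m_assoc)
  also have "\<dots> = \<theta> x \<otimes>\<^bsub>A\<^esub> (\<phi> a \<otimes>\<^bsub>A\<^esub> word_product A \<theta> w)"
    using c x assms by (simp add: scalar_commute A.m_assoc)
  also have "\<dots> = word_product A \<theta> (x # w) \<otimes>\<^bsub>A\<^esub> \<phi> a"
    using c Cons by (simp add: word_product_def A.m_assoc)
  finally show ?case .
qed

text \<open>The sum that defines the lift runs over the support, which differs between the summands of a
  sum. This lemma passes to a common index set.\<close>

lemma lift_superset:
  assumes "f \<in> carrier F" "finite S" "{w. f w \<noteq> \<zero>\<^bsub>K\<^esub>} \<subseteq> S" "S \<subseteq> lists X"
  shows "lift f = (\<Oplus>\<^bsub>A\<^esub>w \<in> S. \<phi> (f w) \<otimes>\<^bsub>A\<^esub> word_product A \<theta> w)"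
  unfolding algebra_lift_def
  by (rule A.add.finprod_mono_neutral_cong_left)
    (use assms in \<open>auto simp: scalar_zero word_product_closed scalar_closed coeff_closed subset_iff\<close>)

lemma lift_monomial:
  assumes "a \<in> carrier K" "w \<in> lists X"
  shows "lift (monomial K a w) = \<phi> a \<otimes>\<^bsub>A\<^esub> word_product A \<theta> w"
proof -
  have "lift (monomial K a w) = (\<Oplus>\<^bsub>A\<^esub>u \<in> {w}. \<phi> (monomial K a w u) \<otimes>\<^bsub>A\<^esub> word_product A \<theta> u)"
    by (rule lift_superset[OF monomial_closed[OF assms]])
      (use assms(2) in \<open>auto simp: monomial_def simp del: in_lists_conv_set\<close>)
  then show ?thesis
    using assms by (simp add: monomial_def scalar_closed word_product_closed)
qed

lemma lift_closed: "f \<in> carrier F \<Longrightarrow> lift f \<in> carrier A"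
  unfolding algebra_lift_def
  by (rule A.finsum_closed)
    (auto simp: carrier_iff subset_iff simp del: in_lists_conv_set
      intro!: A.m_closed scalar_closed word_product_closed)

lemma lift_add:
  assumes f: "f \<in> carrier F" and g: "g \<in> carrier F"
  shows "lift (f \<oplus>\<^bsub>F\<^esub> g) = lift f \<oplus>\<^bsub>A\<^esub> lift g"
proof -
  let ?S = "{w. f w \<noteq> \<zero>\<^bsub>K\<^esub>} \<union> {w. g w \<noteq> \<zero>\<^bsub>K\<^esub>}"
  have S: "finite ?S" "?S \<subseteq> lists X"
    using assms by (auto simp: carrier_iff)
  have term_closed: "\<phi> (h w) \<otimes>\<^bsub>A\<^esub> word_product A \<theta> w \<in> carrier A" if "h \<in> carrier F" "w \<in> ?S" for h w
    using that S(2) by (blast intro: A.m_closed scalar_closed word_product_closed coeff_closed)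
  have "lift (f \<oplus>\<^bsub>F\<^esub> g) = (\<Oplus>\<^bsub>A\<^esub>w \<in> ?S. \<phi> ((f \<oplus>\<^bsub>F\<^esub> g) w) \<otimes>\<^bsub>A\<^esub> word_product A \<theta> w)"
    by (rule lift_superset) (use assms S in \<open>auto simp: add_closed add_apply\<close>)
  also have "\<dots> = (\<Oplus>\<^bsub>A\<^esub>w \<in> ?S. \<phi> (f w) \<otimes>\<^bsub>A\<^esub> word_product A \<theta> w \<oplus>\<^bsub>A\<^esub> \<phi> (g w) \<otimes>\<^bsub>A\<^esub> word_product A \<theta> w)"
  proof (rule A.finsum_cong')
    show "(\<lambda>w. \<phi> (f w) \<otimes>\<^bsub>A\<^esub> word_product A \<theta> w \<oplus>\<^bsub>A\<^esub> \<phi> (g w) \<otimes>\<^bsub>A\<^esub> word_product A \<theta> w) \<in> ?S \<rightarrow> carrier A"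
      using term_closed f g by auto
    fix w assume "w \<in> ?S"
    then show "\<phi> ((f \<oplus>\<^bsub>F\<^esub> g) w) \<otimes>\<^bsub>A\<^esub> word_product A \<theta> w =
        \<phi> (f w) \<otimes>\<^bsub>A\<^esub> word_product A \<theta> w \<oplus>\<^bsub>A\<^esub> \<phi> (g w) \<otimes>\<^bsub>A\<^esub> word_product A \<theta> w"
      using word_product_closed[OF subsetD[OF S(2)]] coeff_closed[OF f, of w] coeff_closed[OF g, of w]
      by (simp add: add_apply ring_hom_add[OF scalar_hom] A.l_distr scalar_closed)
  qed simp
  also have "\<dots> = (\<Oplus>\<^bsub>A\<^esub>w \<in> ?S. \<phi> (f w) \<otimes>\<^bsub>A\<^esub> word_product A \<theta> w)
      \<oplus>\<^bsub>A\<^esub> (\<Oplus>\<^bsub>A\<^esub>w \<in> ?S. \<phi> (g w) \<otimes>\<^bsub>A\<^esub> word_product A \<theta> w)"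
    by (rule A.finsum_addf) (use term_closed f g in auto)
  also have "\<dots> = lift f \<oplus>\<^bsub>A\<^esub> lift g"
    using lift_superset[OF f S(1) _ S(2)] lift_superset[OF g S(1) _ S(2)] by simp
  finally show ?thesis .
qed

text \<open>Both sides are biadditive, so it suffices to treat monomials. There the scalar of the second
  factor has to be moved past the word of the first, which is \<open>scalar_word_commute\<close>.\<close>

lemma lift_mult:
  assumes "f \<in> carrier F" "g \<in> carrier F"
  shows "lift (f \<otimes>\<^bsub>F\<^esub> g) = lift f \<otimes>\<^bsub>A\<^esub> lift g"
proof -
  interpret F: ring F by (rule ring_free_algebra)
  have mono: "lift (monomial K a u \<otimes>\<^bsub>F\<^esub> monomial K b v)
      = lift (monomial K a u) \<otimes>\<^bsub>A\<^esub> lift (monomial K b v)"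
    if "a \<in> carrier K" "b \<in> carrier K" "u \<in> lists X" "v \<in> lists X" for a b u v
  proof -
    define p q where "p = word_product A \<theta> u" and "q = word_product A \<theta> v"
    have c: "\<phi> a \<in> carrier A" "\<phi> b \<in> carrier A" "p \<in> carrier A" "q \<in> carrier A"
      using that by (simp_all add: scalar_closed word_product_closed p_def q_def)
    have "lift (monomial K a u \<otimes>\<^bsub>F\<^esub> monomial K b v) = (\<phi> a \<otimes>\<^bsub>A\<^esub> \<phi> b) \<otimes>\<^bsub>A\<^esub> (p \<otimes>\<^bsub>A\<^esub> q)"
      using that by (simp add: monomial_mult lift_monomial word_product_append
          ring_hom_mult[OF scalar_hom] p_def q_def)
    also have "\<dots> = \<phi> a \<otimes>\<^bsub>A\<^esub> ((\<phi> b \<otimes>\<^bsub>A\<^esub> p) \<otimes>\<^bsub>A\<^esub> q)"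
      using c by (simp add: A.m_assoc)
    also have "\<phi> b \<otimes>\<^bsub>A\<^esub> p = p \<otimes>\<^bsub>A\<^esub> \<phi> b"
      unfolding p_def using that by (simp add: scalar_word_commute)
    also have "\<phi> a \<otimes>\<^bsub>A\<^esub> ((p \<otimes>\<^bsub>A\<^esub> \<phi> b) \<otimes>\<^bsub>A\<^esub> q) = (\<phi> a \<otimes>\<^bsub>A\<^esub> p) \<otimes>\<^bsub>A\<^esub> (\<phi> b \<otimes>\<^bsub>A\<^esub> q)"
      using c by (simp add: A.m_assoc)
    finally show ?thesis
      using that by (simp add: lift_monomial p_def q_def)
  qed
  have left: "lift (monomial K a u \<otimes>\<^bsub>F\<^esub> g) = lift (monomial K a u) \<otimes>\<^bsub>A\<^esub> lift g"
    if "a \<in> carrier K" "u \<in> lists X" for a u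
    using assms(2)
  proof (induction rule: span_induct)
    case (monomial b v)
    then show ?case using that mono by simp
  next
    case (add g h)
    then show ?case
      using that by (simp add: F.r_distr monomial_closed lift_add lift_closed A.r_distr)
  qed
  from assms(1) show ?thesis
  proof (induction rule: span_induct)
    case (monomial a u)
    then show ?case by (rule left)
  next
    case (add f h)
    then show ?case
      using assms(2) by (simp add: F.l_distr lift_add lift_closed A.l_distr)
  qed
qed

lemma lift_scalar: "a \<in> carrier K \<Longrightarrow> lift (monomial K a []) = \<phi> a"
  by (simp add: lift_monomial word_product_def scalar_closed)

lemma lift_gen: "x \<in> X \<Longrightarrow> lift (free_gen K x) = \<theta> x"
  by (simp add: free_gen_eq_monomial lift_monomial word_product_def gen_image
      ring_hom_one[OF scalar_hom])

lemma lift_ring_hom: "lift \<in> ring_hom F A"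
  by (rule ring_hom_memI)
    (simp_all add: lift_closed lift_mult lift_add one_eq_monomial lift_scalar
      ring_hom_one[OF scalar_hom])

end

section \<open>Endomorphism rings of modules\<close>

lemma linear_mapsI:
  assumes "f \<in> carrier V \<rightarrow>\<^sub>E carrier W"
    and "\<And>x y. x \<in> carrier V \<Longrightarrow> y \<in> carrier V \<Longrightarrow> f (x \<oplus>\<^bsub>V\<^esub> y) = f x \<oplus>\<^bsub>W\<^esub> f y"
    and "\<And>a x. a \<in> carrier K \<Longrightarrow> x \<in> carrier V \<Longrightarrow> f (a \<odot>\<^bsub>V\<^esub> x) = a \<odot>\<^bsub>W\<^esub> f x"
  shows "f \<in> linear_maps K V W"
  using assms by (simp add: linear_maps_def)

lemma
  assumes "f \<in> linear_maps K V W"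
  shows linear_maps_PiE: "f \<in> carrier V \<rightarrow>\<^sub>E carrier W"
    and linear_maps_closed: "x \<in> carrier V \<Longrightarrow> f x \<in> carrier W"
    and linear_maps_add:
      "x \<in> carrier V \<Longrightarrow> y \<in> carrier V \<Longrightarrow> f (x \<oplus>\<^bsub>V\<^esub> y) = f x \<oplus>\<^bsub>W\<^esub> f y"
    and linear_maps_smult:
      "a \<in> carrier K \<Longrightarrow> x \<in> carrier V \<Longrightarrow> f (a \<odot>\<^bsub>V\<^esub> x) = a \<odot>\<^bsub>W\<^esub> f x"
  using assms by (auto simp: linear_maps_def)

lemma linear_maps_eqI:
  assumes "f \<in> linear_maps K V W" "g \<in> linear_maps K' V W'" "\<And>x. x \<in> carrier V \<Longrightarrow> f x = g x"
  shows "f = g"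
proof (rule extensionalityI[where A = "carrier V"])
  show "f \<in> extensional (carrier V)" "g \<in> extensional (carrier V)"
    using assms(1,2)[THEN linear_maps_PiE] by (auto simp: PiE_def)
qed (rule assms(3))

lemma linear_maps_compose:
  assumes "f \<in> linear_maps K U V" "g \<in> linear_maps K V W"
    and "\<And>x y. x \<in> carrier U \<Longrightarrow> y \<in> carrier U \<Longrightarrow> x \<oplus>\<^bsub>U\<^esub> y \<in> carrier U"
    and "\<And>a x. a \<in> carrier K \<Longrightarrow> x \<in> carrier U \<Longrightarrow> a \<odot>\<^bsub>U\<^esub> x \<in> carrier U"
  shows "compose (carrier U) g f \<in> linear_maps K U W"
  by (rule linear_mapsI)
    (use assms in \<open>auto simp: compose_eq linear_maps_add linear_maps_smult linear_maps_closed
       compose_def\<close>)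

definition endomorphism_ring :: "('k, 'c) ring_scheme \<Rightarrow> ('k, 'v) module \<Rightarrow> ('v \<Rightarrow> 'v) ring" where
  "endomorphism_ring K V =
    \<lparr>carrier = linear_maps K V V,
     mult = compose (carrier V),
     one = (\<lambda>v \<in> carrier V. v),
     zero = (\<lambda>v \<in> carrier V. \<zero>\<^bsub>V\<^esub>),
     add = (\<lambda>f g. \<lambda>v \<in> carrier V. f v \<oplus>\<^bsub>V\<^esub> g v)\<rparr>"

text \<open>Since the scalars commute, multiplication by a scalar is linear, and linearity of the other
  endomorphisms means that they commute with it. Homotheties thus make the endomorphism ring an
  algebra over the scalars.\<close>

definition homothety :: "('k, 'v) module \<Rightarrow> 'k \<Rightarrow> 'v \<Rightarrow> 'v" where
  "homothety V a = (\<lambda>v \<in> carrier V. a \<odot>\<^bsub>V\<^esub> v)"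

context
  fixes K :: "('k, 'c) ring_scheme" and V :: "('k, 'v) module"
  assumes V: "module K V"
begin

interpretation V: module K V by (rule V)

lemma homothety_linear: "a \<in> carrier K \<Longrightarrow> homothety V a \<in> linear_maps K V V"
  by (rule linear_mapsI)
    (auto simp: homothety_def V.smult_r_distr V.smult_assoc1[symmetric] V.R.m_comm)

lemma linear_maps_compose_closed:
  "f \<in> linear_maps K V U \<Longrightarrow> g \<in> linear_maps K U W \<Longrightarrow> compose (carrier V) g f \<in> linear_maps K V W"
  by (rule linear_maps_compose) auto

lemma ring_endomorphism_ring: "ring (endomorphism_ring K V)" (is "ring ?E")
proof (rule ringI)
  have add: "f \<oplus>\<^bsub>?E\<^esub> g \<in> linear_maps K V V"
    if "f \<in> linear_maps K V V" "g \<in> linear_maps K V V" for f g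
    unfolding endomorphism_ring_def
    by (rule linear_mapsI)
      (use that in \<open>auto simp: linear_maps_add linear_maps_smult linear_maps_closed
         V.smult_r_distr V.a_ac\<close>)
  have zero: "\<zero>\<^bsub>?E\<^esub> \<in> linear_maps K V V"
    unfolding endomorphism_ring_def by (rule linear_mapsI) auto
  have one: "\<one>\<^bsub>?E\<^esub> \<in> linear_maps K V V"
    unfolding endomorphism_ring_def by (rule linear_mapsI) auto
  note comp = linear_maps_compose_closed
  note ext = linear_maps_eqI[where K = K and K' = K and V = V and W = V and W' = V]
  show "abelian_group ?E"
  proof (rule abelian_groupI, goal_cases)
    case (1 f g)
    then show ?case using add by (simp add: endomorphism_ring_def)
  next
    case 2
    then show ?case using zero by (simp add: endomorphism_ring_def)
  next
    case (3 f g h)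
    then show ?case
      by (auto simp: endomorphism_ring_def linear_maps_closed V.M.a_assoc)
  next
    case (4 f g)
    then show ?case
      by (auto simp: endomorphism_ring_def linear_maps_closed V.M.a_comm)
  next
    case (5 f)
    then have f: "f \<in> linear_maps K V V" by (simp add: endomorphism_ring_def)
    show ?case
      by (rule ext[OF add[OF zero f] f]) (use f in \<open>simp add: endomorphism_ring_def linear_maps_closed\<close>)
  next
    case (6 f)
    then have f: "f \<in> linear_maps K V V" by (simp add: endomorphism_ring_def)
    \<comment> \<open>The additive inverse of \<open>f\<close> is \<open>f\<close> followed by the homothety of ratio \<open>- 1\<close>.\<close>
    define g where "g = compose (carrier V) (homothety V (\<ominus>\<^bsub>K\<^esub> \<one>\<^bsub>K\<^esub>)) f"
    have g: "g \<in> linear_maps K V V"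
      unfolding g_def by (rule comp[OF f homothety_linear]) simp
    have "g \<oplus>\<^bsub>?E\<^esub> f = \<zero>\<^bsub>?E\<^esub>"
      by (rule ext[OF add[OF g f] zero])
        (use f in \<open>simp add: endomorphism_ring_def g_def compose_eq homothety_def linear_maps_closed
          V.smult_l_minus V.M.l_neg\<close>)
    with g show ?case by (auto simp: endomorphism_ring_def)
  qed
  show "monoid ?E"
  proof (rule monoidI, goal_cases)
    case (1 f g)
    then show ?case using comp[of g V f V] by (simp add: endomorphism_ring_def)
  next
    case 2
    then show ?case using one by (simp add: endomorphism_ring_def)
  next
    case (3 f g h)
    then show ?case
      by (auto simp: endomorphism_ring_def linear_maps_closed compose_def)
  next
    case (4 f)
    then have f: "f \<in> linear_maps K V V" by (simp add: endomorphism_ring_def)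
    show ?case
      using Id_compose[of f "carrier V" "carrier V"] linear_maps_PiE[OF f]
      by (simp add: endomorphism_ring_def PiE_def)
  next
    case (5 f)
    then have f: "f \<in> linear_maps K V V" by (simp add: endomorphism_ring_def)
    show ?case
      using compose_Id[of f "carrier V" "carrier V"] linear_maps_PiE[OF f]
      by (simp add: endomorphism_ring_def PiE_def)
  qed
  show "(f \<oplus>\<^bsub>?E\<^esub> g) \<otimes>\<^bsub>?E\<^esub> h = f \<otimes>\<^bsub>?E\<^esub> h \<oplus>\<^bsub>?E\<^esub> g \<otimes>\<^bsub>?E\<^esub> h"
    if "f \<in> carrier ?E" "g \<in> carrier ?E" "h \<in> carrier ?E" for f g h
    using that by (auto simp: endomorphism_ring_def compose_def linear_maps_closed)
  show "h \<otimes>\<^bsub>?E\<^esub> (f \<oplus>\<^bsub>?E\<^esub> g) = h \<otimes>\<^bsub>?E\<^esub> f \<oplus>\<^bsub>?E\<^esub> h \<otimes>\<^bsub>?E\<^esub> g"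
    if "f \<in> carrier ?E" "g \<in> carrier ?E" "h \<in> carrier ?E" for f g h
    using that by (auto simp: endomorphism_ring_def compose_def linear_maps_closed linear_maps_add)
qed

lemma homothety_ring_hom: "homothety V \<in> ring_hom K (endomorphism_ring K V)"
proof (rule ring_hom_memI)
  show "homothety V a \<in> carrier (endomorphism_ring K V)" if "a \<in> carrier K" for a
    using homothety_linear[OF that] by (simp add: endomorphism_ring_def)
qed (auto simp: endomorphism_ring_def homothety_def compose_def V.smult_assoc1 V.smult_l_distr)

lemma homothety_commute:
  assumes "a \<in> carrier K" "f \<in> linear_maps K V V"
  shows "homothety V a \<otimes>\<^bsub>endomorphism_ring K V\<^esub> f = f \<otimes>\<^bsub>endomorphism_ring K V\<^esub> homothety V a"
  using assms
  by (auto simp: endomorphism_ring_def homothety_def compose_def linear_maps_closed linear_maps_smult)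

end

section \<open>The enveloping algebra by generators and relations\<close>

definition env_class ::
  "('k, 'c) ring_scheme \<Rightarrow> 'd digroup \<Rightarrow> ('d symbol list \<Rightarrow> 'k) \<Rightarrow> ('d symbol list \<Rightarrow> 'k) set" where
  "env_class K D f =
    genideal (env_free_algebra K D) (env_relators K D) +>\<^bsub>env_free_algebra K D\<^esub> f"

lemma quotient_algebra_simps:
  "carrier (quotient_algebra F I) = carrier (F Quot I)"
  "mult (quotient_algebra F I) = mult (F Quot I)"
  "one (quotient_algebra F I) = one (F Quot I)"
  "add (quotient_algebra F I) = add (F Quot I)"
  "zero (quotient_algebra F I) = zero (F Quot I)"
  by (simp_all add: quotient_algebra_def ring.extend_def)

text \<open>The enveloping algebra extends a quotient ring by a scalar multiplication, hence is a different
  record with the same ring operations.\<close>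

lemma ring_congruence:
  assumes "ring A" "carrier B = carrier A" "mult B = mult A" "one B = one A"
    "add B = add A" "zero B = zero A"
  shows "ring B"
proof -
  interpret ring A by (rule assms(1))
  show ?thesis
    by (rule ringI; (rule abelian_groupI | rule monoidI)?)
      (auto simp: assms(2-) a_ac m_assoc l_distr r_distr intro!: add.l_inv_ex[simplified])
qed

locale enveloping_setting =
  digroup: generalized_digroup D + scalars: field K +
  free_algebra_setting K "L ` carrier D \<union> R ` carrier D"
  for K :: "('k, 'c) ring_scheme" and D :: "'d digroup"
begin

abbreviation E :: "('k, ('d symbol list \<Rightarrow> 'k) set) module" where
  "E \<equiv> enveloping_algebra K D"

abbreviation cls :: "('d symbol list \<Rightarrow> 'k) \<Rightarrow> ('d symbol list \<Rightarrow> 'k) set" where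
  "cls \<equiv> env_class K D"

abbreviation I :: "('d symbol list \<Rightarrow> 'k) set" where
  "I \<equiv> genideal F (env_relators K D)"

lemma env_free_algebra_eq: "env_free_algebra K D = F"
  by (simp add: env_free_algebra_def)

lemma L_closed: "x \<in> carrier D \<Longrightarrow> free_gen K (L x) \<in> carrier F"
  and R_closed: "x \<in> carrier D \<Longrightarrow> free_gen K (R x) \<in> carrier F"
  by (auto intro: gen_closed)

lemma env_relators_closed: "env_relators K D \<subseteq> carrier F"
proof -
  interpret F: ring F by (rule ring_free_algebra)
  show ?thesis
    unfolding env_relators_def Let_def env_free_algebra_eq
    using digroup.halo_subset
    by (auto intro!: F.minus_closed L_closed R_closed F.m_closed
        digroup.lprod_closed digroup.rprod_closed)
qed

lemma ideal_I: "ideal I F"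
  by (rule ring.genideal_ideal[OF ring_free_algebra env_relators_closed])

lemma env_relators_sub: "env_relators K D \<subseteq> I"
  by (rule ring.genideal_self[OF ring_free_algebra env_relators_closed])

lemma ring_env: "ring E"
  by (rule ring_congruence[OF ideal.quotient_is_ring[OF ideal_I]])
    (simp_all add: enveloping_algebra_def env_free_algebra_eq quotient_algebra_simps)

lemma env_class_hom: "cls \<in> ring_hom F E"
  using ideal.rcos_ring_hom[OF ideal_I]
  by (simp add: ring_hom_def env_class_def[abs_def] enveloping_algebra_def env_free_algebra_eq
      quotient_algebra_simps)

lemma carrier_env: "carrier E = cls ` carrier F"
  by (auto simp: enveloping_algebra_def env_free_algebra_eq quotient_algebra_simps
      FactRing_def A_RCOSETS_def' env_class_def)

lemma env_class_eq_iff: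
  assumes "f \<in> carrier F" "g \<in> carrier F"
  shows "cls f = cls g \<longleftrightarrow> f \<ominus>\<^bsub>F\<^esub> g \<in> I"
  using ring.quotient_eq_iff_same_a_r_cos[OF ring_free_algebra ideal_I assms]
  by (simp add: env_class_def env_free_algebra_eq)

lemma env_relation:
  assumes "f \<ominus>\<^bsub>F\<^esub> g \<in> env_relators K D" "f \<in> carrier F" "g \<in> carrier F"
  shows "cls f = cls g"
  using assms env_relators_sub env_class_eq_iff by blast

lemma
  assumes x: "x \<in> carrier D" and y: "y \<in> carrier D"
  shows env_lprod: "cls (free_gen K (L (x \<stileturn>\<^bsub>D\<^esub> y))) = cls (free_gen K (L x)) \<otimes>\<^bsub>E\<^esub> cls (free_gen K (L y))"
    and env_rprod: "cls (free_gen K (R (x \<turnstile>\<^bsub>D\<^esub> y))) = cls (free_gen K (R x)) \<otimes>\<^bsub>E\<^esub> cls (free_gen K (R y))"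
    and env_R_L: "cls (free_gen K (R x)) \<otimes>\<^bsub>E\<^esub> cls (free_gen K (L y)) = cls (free_gen K (L (x \<turnstile>\<^bsub>D\<^esub> y)))"
    and env_L_R: "cls (free_gen K (L x)) \<otimes>\<^bsub>E\<^esub> cls (free_gen K (R y)) = cls (free_gen K (L (x \<stileturn>\<^bsub>D\<^esub> y)))"
proof -
  note xy = digroup.lprod_closed[OF x y] digroup.rprod_closed[OF x y]
  note closed = x[THEN L_closed] x[THEN R_closed] y[THEN L_closed] y[THEN R_closed]
    xy[THEN L_closed] xy[THEN R_closed]
  note hom = ring_hom_mult[OF env_class_hom, symmetric]
  have "free_gen K (L (x \<stileturn>\<^bsub>D\<^esub> y)) \<ominus>\<^bsub>F\<^esub> (free_gen K (L x) \<otimes>\<^bsub>F\<^esub> free_gen K (L y)) \<in> env_relators K D"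
    unfolding env_relators_def Let_def env_free_algebra_eq using x y by blast
  then show "cls (free_gen K (L (x \<stileturn>\<^bsub>D\<^esub> y))) = cls (free_gen K (L x)) \<otimes>\<^bsub>E\<^esub> cls (free_gen K (L y))"
    using closed by (simp add: hom env_relation mult_closed)
  have "free_gen K (R (x \<turnstile>\<^bsub>D\<^esub> y)) \<ominus>\<^bsub>F\<^esub> (free_gen K (R x) \<otimes>\<^bsub>F\<^esub> free_gen K (R y)) \<in> env_relators K D"
    unfolding env_relators_def Let_def env_free_algebra_eq using x y by blast
  then show "cls (free_gen K (R (x \<turnstile>\<^bsub>D\<^esub> y))) = cls (free_gen K (R x)) \<otimes>\<^bsub>E\<^esub> cls (free_gen K (R y))"
    using closed by (simp add: hom env_relation mult_closed)
  have "(free_gen K (R x) \<otimes>\<^bsub>F\<^esub> free_gen K (L y)) \<ominus>\<^bsub>F\<^esub> free_gen K (L (x \<turnstile>\<^bsub>D\<^esub> y)) \<in> env_relators K D"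
    unfolding env_relators_def Let_def env_free_algebra_eq using x y by blast
  then show "cls (free_gen K (R x)) \<otimes>\<^bsub>E\<^esub> cls (free_gen K (L y)) = cls (free_gen K (L (x \<turnstile>\<^bsub>D\<^esub> y)))"
    using closed by (simp add: hom env_relation mult_closed)
  have "(free_gen K (L x) \<otimes>\<^bsub>F\<^esub> free_gen K (R y)) \<ominus>\<^bsub>F\<^esub> free_gen K (L (x \<stileturn>\<^bsub>D\<^esub> y)) \<in> env_relators K D"
    unfolding env_relators_def Let_def env_free_algebra_eq using x y by blast
  then show "cls (free_gen K (L x)) \<otimes>\<^bsub>E\<^esub> cls (free_gen K (R y)) = cls (free_gen K (L (x \<stileturn>\<^bsub>D\<^esub> y)))"
    using closed by (simp add: hom env_relation mult_closed)
qed

lemma env_unit: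
  assumes "e \<in> halo D"
  shows "cls (free_gen K (R e)) = \<one>\<^bsub>E\<^esub>"
proof -
  interpret F: ring F by (rule ring_free_algebra)
  have "free_gen K (R e) \<ominus>\<^bsub>F\<^esub> \<one>\<^bsub>F\<^esub> \<in> env_relators K D"
    unfolding env_relators_def Let_def env_free_algebra_eq using assms by blast
  then have "cls (free_gen K (R e)) = cls \<one>\<^bsub>F\<^esub>"
    by (rule env_relation) (use assms digroup.halo_subset in \<open>auto intro: R_closed\<close>)
  then show ?thesis
    by (simp add: ring_hom_one[OF env_class_hom])
qed

text \<open>A homomorphism respecting the five families of relations vanishes on the relators. Its kernel is
  an ideal, hence contains the ideal that the relators generate.\<close>

lemma env_descent:
  assumes B: "ring B" and h: "h \<in> ring_hom F B"
    and h_lprod: "\<And>x y. x \<in> carrier D \<Longrightarrow> y \<in> carrier D \<Longrightarrow>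
      h (free_gen K (L (x \<stileturn>\<^bsub>D\<^esub> y))) = h (free_gen K (L x)) \<otimes>\<^bsub>B\<^esub> h (free_gen K (L y))"
    and h_rprod: "\<And>x y. x \<in> carrier D \<Longrightarrow> y \<in> carrier D \<Longrightarrow>
      h (free_gen K (R (x \<turnstile>\<^bsub>D\<^esub> y))) = h (free_gen K (R x)) \<otimes>\<^bsub>B\<^esub> h (free_gen K (R y))"
    and h_unit: "\<And>e. e \<in> halo D \<Longrightarrow> h (free_gen K (R e)) = \<one>\<^bsub>B\<^esub>"
    and h_R_L: "\<And>x y. x \<in> carrier D \<Longrightarrow> y \<in> carrier D \<Longrightarrow>
      h (free_gen K (R x)) \<otimes>\<^bsub>B\<^esub> h (free_gen K (L y)) = h (free_gen K (L (x \<turnstile>\<^bsub>D\<^esub> y)))"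
    and h_L_R: "\<And>x y. x \<in> carrier D \<Longrightarrow> y \<in> carrier D \<Longrightarrow>
      h (free_gen K (L x)) \<otimes>\<^bsub>B\<^esub> h (free_gen K (R y)) = h (free_gen K (L (x \<stileturn>\<^bsub>D\<^esub> y)))"
    and f: "f \<in> carrier F" and g: "g \<in> carrier F" and eq: "cls f = cls g"
  shows "h f = h g"
proof -
  interpret h: ring_hom_ring F B h
    using ring_free_algebra B h by (rule ring_hom_ringI2)
  have minus: "h (p \<ominus>\<^bsub>F\<^esub> q) = h p \<ominus>\<^bsub>B\<^esub> h q" if "p \<in> carrier F" "q \<in> carrier F" for p q
    unfolding h.R.minus_eq h.S.minus_eq using that by simp
  have kernel: "p \<ominus>\<^bsub>F\<^esub> q \<in> a_kernel F B h"
    if "h p = h q" "p \<in> carrier F" "q \<in> carrier F" for p q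
  proof -
    have "h (p \<ominus>\<^bsub>F\<^esub> q) = \<zero>\<^bsub>B\<^esub>"
      unfolding minus[OF that(2,3)] that(1) h.S.minus_eq
      by (rule h.S.r_neg[OF h.hom_closed[OF that(3)]])
    with h.R.minus_closed[OF that(2,3)] show ?thesis
      unfolding a_kernel_def' by blast
  qed
  have "r \<in> a_kernel F B h" if r: "r \<in> env_relators K D" for r
  proof -
    note closed = L_closed R_closed mult_closed digroup.lprod_closed digroup.rprod_closed
      digroup.halo_subset[THEN subsetD] h.R.one_closed
    consider
      (lprod) x y where "r = free_gen K (L (x \<stileturn>\<^bsub>D\<^esub> y)) \<ominus>\<^bsub>F\<^esub> (free_gen K (L x) \<otimes>\<^bsub>F\<^esub> free_gen K (L y))" "x \<in> carrier D" "y \<in> carrier D"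
    | (rprod) x y where "r = free_gen K (R (x \<turnstile>\<^bsub>D\<^esub> y)) \<ominus>\<^bsub>F\<^esub> (free_gen K (R x) \<otimes>\<^bsub>F\<^esub> free_gen K (R y))" "x \<in> carrier D" "y \<in> carrier D"
    | (unit) e where "r = free_gen K (R e) \<ominus>\<^bsub>F\<^esub> \<one>\<^bsub>F\<^esub>" "e \<in> halo D"
    | (R_L) x y where "r = (free_gen K (R x) \<otimes>\<^bsub>F\<^esub> free_gen K (L y)) \<ominus>\<^bsub>F\<^esub> free_gen K (L (x \<turnstile>\<^bsub>D\<^esub> y))" "x \<in> carrier D" "y \<in> carrier D"
    | (L_R) x y where "r = (free_gen K (L x) \<otimes>\<^bsub>F\<^esub> free_gen K (R y)) \<ominus>\<^bsub>F\<^esub> free_gen K (L (x \<stileturn>\<^bsub>D\<^esub> y))" "x \<in> carrier D" "y \<in> carrier D"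
      using r unfolding env_relators_def Let_def env_free_algebra_eq by blast
    then show ?thesis
    proof cases
      case lprod
      show ?thesis
        unfolding lprod(1)
        by (rule kernel) (simp_all only: h.hom_mult h.hom_one closed h_lprod[of x y] lprod(2-))
    next
      case rprod
      show ?thesis
        unfolding rprod(1)
        by (rule kernel) (simp_all only: h.hom_mult h.hom_one closed h_rprod[of x y] rprod(2-))
    next
      case unit
      show ?thesis
        unfolding unit(1)
        by (rule kernel) (simp_all only: h.hom_mult h.hom_one closed h_unit[of e] unit(2-))
    next
      case R_L
      show ?thesis
        unfolding R_L(1)
        by (rule kernel) (simp_all only: h.hom_mult h.hom_one closed h_R_L[of x y] R_L(2-))
    next
      case L_R
      show ?thesis
        unfolding L_R(1)
        by (rule kernel) (simp_all only: h.hom_mult h.hom_one closed h_L_R[of x y] L_R(2-))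
    qed
  qed
  then have "env_relators K D \<subseteq> a_kernel F B h"
    by blast
  then have "I \<subseteq> a_kernel F B h"
    by (rule ring.genideal_minimal[OF ring_free_algebra h.kernel_is_ideal])
  moreover have "f \<ominus>\<^bsub>F\<^esub> g \<in> I"
    using eq env_class_eq_iff[OF f g] by blast
  ultimately have "h (f \<ominus>\<^bsub>F\<^esub> g) = \<zero>\<^bsub>B\<^esub>"
    unfolding a_kernel_def' by blast
  then have "h f \<oplus>\<^bsub>B\<^esub> (\<ominus>\<^bsub>B\<^esub> h g) = \<zero>\<^bsub>B\<^esub>"
    unfolding minus[OF f g] h.S.minus_eq .
  then have "\<ominus>\<^bsub>B\<^esub> (\<ominus>\<^bsub>B\<^esub> h g) = h f"
    by (intro h.S.minus_equality h.S.a_inv_closed h.hom_closed f g)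
  then show ?thesis
    using h.hom_closed[OF g] by (simp only: h.S.minus_minus)
qed

lemma env_scalar_central:
  assumes "a \<in> carrier K" "f \<in> carrier F"
  shows "cls (monomial K a []) \<otimes>\<^bsub>E\<^esub> cls f = cls f \<otimes>\<^bsub>E\<^esub> cls (monomial K a [])"
proof -
  have "monomial K a [] \<in> carrier F"
    using assms by (simp add: monomial_closed)
  then show ?thesis
    by (simp only: ring_hom_mult[OF env_class_hom, symmetric] assms(2) scalar_central[OF assms])
qed

end

section \<open>From representations to modules\<close>

definition env_action ::
  "('k, 'c) ring_scheme \<Rightarrow> ('k, 'd, 'v) rep \<Rightarrow> ('d symbol list \<Rightarrow> 'k) \<Rightarrow> 'v \<Rightarrow> 'v" where
  "env_action K = (\<lambda>(V, lam, rho).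
     algebra_lift K (endomorphism_ring K V) (homothety V) (case_symbol lam rho))"

text \<open>A class acts through one of its representatives. The choice is immaterial by
  \<open>env_action_cong\<close>.\<close>

definition env_module ::
  "('k, 'c) ring_scheme \<Rightarrow> 'd digroup \<Rightarrow> ('k, 'd, 'v) rep
    \<Rightarrow> (('d symbol list \<Rightarrow> 'k) set, 'v) module" where
  "env_module K D = (\<lambda>(V, lam, rho).
     \<lparr>carrier = carrier V, mult = mult V, one = one V, zero = zero V, add = add V,
      smult = (\<lambda>a. env_action K (V, lam, rho)
        (inv_into (carrier (env_free_algebra K D)) (env_class K D) a))\<rparr>)"

text \<open>The scalar \<open>a\<close> acts as the class of the constant polynomial \<open>a\<close>, that is, as \<open>a\<close> times the unit
  of the enveloping algebra.\<close>

definition scalar_restriction ::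
  "('k, 'c) ring_scheme \<Rightarrow> 'd digroup \<Rightarrow> (('d symbol list \<Rightarrow> 'k) set, 'v) module
    \<Rightarrow> ('k, 'v) module" where
  "scalar_restriction K D M =
     \<lparr>carrier = carrier M, mult = mult M, one = one M, zero = zero M, add = add M,
      smult = (\<lambda>a. smult M (env_class K D (monomial K a [])))\<rparr>"

definition env_rep ::
  "('k, 'c) ring_scheme \<Rightarrow> 'd digroup \<Rightarrow> (('d symbol list \<Rightarrow> 'k) set, 'v) module
    \<Rightarrow> ('k, 'd, 'v) rep" where
  "env_rep K D M =
     (scalar_restriction K D M,
      \<lambda>x. \<lambda>v \<in> carrier M. env_class K D (free_gen K (L x)) \<odot>\<^bsub>M\<^esub> v,
      \<lambda>x. \<lambda>v \<in> carrier M. env_class K D (free_gen K (R x)) \<odot>\<^bsub>M\<^esub> v)"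

lemma env_module_simps:
  "carrier (env_module K D (V, lam, rho)) = carrier V"
  "add (env_module K D (V, lam, rho)) = add V"
  "zero (env_module K D (V, lam, rho)) = zero V"
  by (simp_all add: env_module_def)

lemma scalar_restriction_simps:
  "carrier (scalar_restriction K D M) = carrier M"
  "add (scalar_restriction K D M) = add M"
  "zero (scalar_restriction K D M) = zero M"
  "a \<odot>\<^bsub>scalar_restriction K D M\<^esub> v = env_class K D (monomial K a []) \<odot>\<^bsub>M\<^esub> v"
  by (simp_all add: scalar_restriction_def)

lemma abelian_group_congruence:
  assumes "abelian_group A" "carrier B = carrier A" "add B = add A" "zero B = zero A"
  shows "abelian_group B"
proof -
  interpret abelian_group A by (rule assms(1))
  show ?thesis
    by (rule abelian_groupI) (auto simp: assms(2-) a_ac intro!: add.l_inv_ex[simplified])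
qed

context enveloping_setting
begin

context
  fixes V :: "('k, 'v) module" and lam rho :: "'d \<Rightarrow> 'v \<Rightarrow> 'v"
  assumes rep: "representation K D V lam rho"
begin

lemma rep_module: "module K V"
  using rep unfolding representation_def by blast

lemma rep_linear:
  assumes "x \<in> carrier D"
  shows "lam x \<in> linear_maps K V V" and "rho x \<in> linear_maps K V V"
  using assms representation.lam_End[OF rep] representation.rho_Aut[OF rep]
  by (auto simp: linear_auts_def)

lemma action_lifting:
  "free_algebra_lifting K (L ` carrier D \<union> R ` carrier D) (endomorphism_ring K V)
     (homothety V) (case_symbol lam rho)"
proof (intro free_algebra_lifting.intro free_algebra_lifting_axioms.intro)
  show "free_algebra_setting K" by (rule free_algebra_setting_axioms)
  show "ring (endomorphism_ring K V)" by (rule ring_endomorphism_ring[OF rep_module])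
  show "homothety V \<in> ring_hom K (endomorphism_ring K V)" by (rule homothety_ring_hom[OF rep_module])
  fix s :: "'d symbol" assume "s \<in> L ` carrier D \<union> R ` carrier D"
  then have s: "case_symbol lam rho s \<in> linear_maps K V V"
    using rep_linear by auto
  then show "case_symbol lam rho s \<in> carrier (endomorphism_ring K V)"
    by (simp add: endomorphism_ring_def)
  fix a assume "a \<in> carrier K"
  with s show "homothety V a \<otimes>\<^bsub>endomorphism_ring K V\<^esub> case_symbol lam rho s
      = case_symbol lam rho s \<otimes>\<^bsub>endomorphism_ring K V\<^esub> homothety V a"
    by (intro homothety_commute rep_module)
qed

lemma env_action_hom: "env_action K (V, lam, rho) \<in> ring_hom F (endomorphism_ring K V)"
  unfolding env_action_def prod.case by (rule free_algebra_lifting.lift_ring_hom[OF action_lifting])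

lemma env_action_scalar: "a \<in> carrier K \<Longrightarrow> env_action K (V, lam, rho) (monomial K a []) = homothety V a"
  unfolding env_action_def prod.case by (rule free_algebra_lifting.lift_scalar[OF action_lifting])

lemma
  assumes "x \<in> carrier D"
  shows env_action_L: "env_action K (V, lam, rho) (free_gen K (L x)) = lam x"
    and env_action_R: "env_action K (V, lam, rho) (free_gen K (R x)) = rho x"
  unfolding env_action_def prod.case
  using free_algebra_lifting.lift_gen[OF action_lifting, of "L x"]
    free_algebra_lifting.lift_gen[OF action_lifting, of "R x"] assms by simp_all

lemma env_action_linear: "f \<in> carrier F \<Longrightarrow> env_action K (V, lam, rho) f \<in> linear_maps K V V"
  using ring_hom_closed[OF env_action_hom] by (simp add: endomorphism_ring_def)

lemma env_action_add:
  assumes "f \<in> carrier F" "g \<in> carrier F" "v \<in> carrier V"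
  shows "env_action K (V, lam, rho) (f \<oplus>\<^bsub>F\<^esub> g) v
    = env_action K (V, lam, rho) f v \<oplus>\<^bsub>V\<^esub> env_action K (V, lam, rho) g v"
  unfolding ring_hom_add[OF env_action_hom assms(1,2)]
  using assms(3) by (simp add: endomorphism_ring_def)

lemma env_action_mult:
  assumes "f \<in> carrier F" "g \<in> carrier F" "v \<in> carrier V"
  shows "env_action K (V, lam, rho) (f \<otimes>\<^bsub>F\<^esub> g) v
    = env_action K (V, lam, rho) f (env_action K (V, lam, rho) g v)"
  unfolding ring_hom_mult[OF env_action_hom assms(1,2)]
  using assms(3) by (simp add: endomorphism_ring_def compose_eq)

lemma env_action_one: "v \<in> carrier V \<Longrightarrow> env_action K (V, lam, rho) \<one>\<^bsub>F\<^esub> v = v"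
  unfolding ring_hom_one[OF env_action_hom] by (simp add: endomorphism_ring_def)

text \<open>The laws of a representation are the relations of the enveloping algebra, written in the
  endomorphism ring.\<close>

lemma env_action_cong:
  assumes "f \<in> carrier F" "g \<in> carrier F" "cls f = cls g"
  shows "env_action K (V, lam, rho) f = env_action K (V, lam, rho) g"
proof (rule env_descent[OF ring_endomorphism_ring[OF rep_module] env_action_hom _ _ _ _ _ assms])
  have mult: "mult (endomorphism_ring K V) = compose (carrier V)"
    by (simp add: endomorphism_ring_def)
  fix x y assume "x \<in> carrier D" "y \<in> carrier D"
  note xy = this digroup.lprod_closed[OF this] digroup.rprod_closed[OF this]
  note gens = xy[THEN env_action_L] xy[THEN env_action_R]
  note laws = representation.lam_lprod[OF rep xy(1,2)] representation.rho_rprod[OF rep xy(1,2)]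
    representation.rho_lam[OF rep xy(1,2)] representation.lam_rho[OF rep xy(1,2)]
  show "env_action K (V, lam, rho) (free_gen K (L (x \<stileturn>\<^bsub>D\<^esub> y))) =
      env_action K (V, lam, rho) (free_gen K (L x)) \<otimes>\<^bsub>endomorphism_ring K V\<^esub> env_action K (V, lam, rho) (free_gen K (L y))"
    "env_action K (V, lam, rho) (free_gen K (R (x \<turnstile>\<^bsub>D\<^esub> y))) =
      env_action K (V, lam, rho) (free_gen K (R x)) \<otimes>\<^bsub>endomorphism_ring K V\<^esub> env_action K (V, lam, rho) (free_gen K (R y))"
    "env_action K (V, lam, rho) (free_gen K (R x)) \<otimes>\<^bsub>endomorphism_ring K V\<^esub> env_action K (V, lam, rho) (free_gen K (L y)) =
      env_action K (V, lam, rho) (free_gen K (L (x \<turnstile>\<^bsub>D\<^esub> y)))"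
    "env_action K (V, lam, rho) (free_gen K (L x)) \<otimes>\<^bsub>endomorphism_ring K V\<^esub> env_action K (V, lam, rho) (free_gen K (R y)) =
      env_action K (V, lam, rho) (free_gen K (L (x \<stileturn>\<^bsub>D\<^esub> y)))"
    unfolding gens mult by (rule laws)+
next
  fix e assume e: "e \<in> halo D"
  then show "env_action K (V, lam, rho) (free_gen K (R e)) = \<one>\<^bsub>endomorphism_ring K V\<^esub>"
    using env_action_R[OF digroup.halo_subset[THEN subsetD, OF e]] representation.rho_unit[OF rep e]
    by (simp add: endomorphism_ring_def)
qed

lemma env_module_smult:
  assumes f: "f \<in> carrier F"
  shows "cls f \<odot>\<^bsub>env_module K D (V, lam, rho)\<^esub> v = env_action K (V, lam, rho) f v"
proof -
  let ?g = "inv_into (carrier F) cls (cls f)"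
  have "cls f \<in> cls ` carrier F"
    using f by (rule imageI)
  then have "?g \<in> carrier F" "cls ?g = cls f"
    by (rule inv_into_into, rule f_inv_into_f)
  then have "env_action K (V, lam, rho) ?g = env_action K (V, lam, rho) f"
    using f by (intro env_action_cong)
  then show ?thesis
    by (simp add: env_module_def env_free_algebra_eq)
qed

lemma left_module_env_module: "left_module E (env_module K D (V, lam, rho))"
proof -
  interpret V: module K V by (rule rep_module)
  interpret F: ring F by (rule ring_free_algebra)
  let ?M = "env_module K D (V, lam, rho)"
  have M: "abelian_group ?M"
    by (rule abelian_group_congruence[OF V.abelian_group_axioms]) (simp_all add: env_module_simps)
  note linear = env_action_linear
  show ?thesis
  proof (intro left_module.intro ring_env M left_module_axioms.intro)
    fix a x assume "a \<in> carrier E" and x: "x \<in> carrier ?M"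
    then obtain f where f: "f \<in> carrier F" "a = cls f"
      unfolding carrier_env by blast
    from x have x: "x \<in> carrier V" by (simp add: env_module_simps)
    show "a \<odot>\<^bsub>?M\<^esub> x \<in> carrier ?M"
      unfolding f(2) env_module_smult[OF f(1)] env_module_simps
      by (rule linear_maps_closed[OF linear[OF f(1)] x])
    fix y assume "y \<in> carrier ?M"
    then have y: "y \<in> carrier V" by (simp add: env_module_simps)
    show "a \<odot>\<^bsub>?M\<^esub> (x \<oplus>\<^bsub>?M\<^esub> y) = a \<odot>\<^bsub>?M\<^esub> x \<oplus>\<^bsub>?M\<^esub> a \<odot>\<^bsub>?M\<^esub> y"
      unfolding f(2) env_module_smult[OF f(1)] env_module_simps
      by (rule linear_maps_add[OF linear[OF f(1)] x y])
  next
    fix x assume "x \<in> carrier ?M"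
    then have x: "x \<in> carrier V" by (simp add: env_module_simps)
    show "\<one>\<^bsub>E\<^esub> \<odot>\<^bsub>?M\<^esub> x = x"
      unfolding ring_hom_one[OF env_class_hom, symmetric] env_module_smult[OF F.one_closed]
      by (rule env_action_one[OF x])
  next
    fix a b x assume "a \<in> carrier E" "b \<in> carrier E" and x: "x \<in> carrier ?M"
    then obtain f g where f: "f \<in> carrier F" "a = cls f" and g: "g \<in> carrier F" "b = cls g"
      unfolding carrier_env by blast
    from x have x: "x \<in> carrier V" by (simp add: env_module_simps)
    show "(a \<oplus>\<^bsub>E\<^esub> b) \<odot>\<^bsub>?M\<^esub> x = a \<odot>\<^bsub>?M\<^esub> x \<oplus>\<^bsub>?M\<^esub> b \<odot>\<^bsub>?M\<^esub> x"
      unfolding f(2) g(2) ring_hom_add[OF env_class_hom f(1) g(1), symmetric]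
        env_module_smult[OF f(1)] env_module_smult[OF g(1)]
        env_module_smult[OF F.a_closed[OF f(1) g(1)]] env_module_simps
      by (rule env_action_add[OF f(1) g(1) x])
    show "(a \<otimes>\<^bsub>E\<^esub> b) \<odot>\<^bsub>?M\<^esub> x = a \<odot>\<^bsub>?M\<^esub> (b \<odot>\<^bsub>?M\<^esub> x)"
      unfolding f(2) g(2) ring_hom_mult[OF env_class_hom f(1) g(1), symmetric]
        env_module_smult[OF f(1)] env_module_smult[OF g(1)]
        env_module_smult[OF F.m_closed[OF f(1) g(1)]]
      by (rule env_action_mult[OF f(1) g(1) x])
  qed
qed

end

text \<open>The elements of the free algebra whose actions commute with \<open>\<phi>\<close> are closed under sums and
  products. They contain the scalars because \<open>\<phi>\<close> is linear, and the generators because it is a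
  morphism.\<close>

lemma rep_morphism_intertwines:
  assumes V: "representation K D V lam rho" and W: "representation K D W lam' rho'"
    and \<phi>: "\<phi> \<in> rep_morphisms K D (V, lam, rho) (W, lam', rho')"
    and f: "f \<in> carrier F" and v: "v \<in> carrier V"
  shows "\<phi> (env_action K (V, lam, rho) f v) = env_action K (W, lam', rho') f (\<phi> v)"
proof -
  have lin: "\<phi> \<in> linear_maps K V W"
    using \<phi> by (simp add: rep_morphisms_def)
  have commute: "\<phi> (lam x v) = lam' x (\<phi> v)" "\<phi> (rho x v) = rho' x (\<phi> v)"
    if "x \<in> carrier D" "v \<in> carrier V" for x v
    using \<phi> that unfolding rep_morphisms_def by (auto simp: compose_def fun_eq_iff) metis+
  from f have "\<forall>v \<in> carrier V. \<phi> (env_action K (V, lam, rho) f v) = env_action K (W, lam', rho') f (\<phi> v)"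
  proof (induction rule: generator_induct)
    case (scalar a)
    then show ?case
      by (simp add: env_action_scalar[OF V] env_action_scalar[OF W] homothety_def
          linear_maps_closed[OF lin] linear_maps_smult[OF lin])
  next
    case (gen s)
    then show ?case
      using commute by (auto simp: env_action_L[OF V] env_action_L[OF W]
          env_action_R[OF V] env_action_R[OF W])
  next
    case (add f g)
    then show ?case
      by (simp add: env_action_add[OF V] env_action_add[OF W] linear_maps_closed[OF lin]
          linear_maps_add[OF lin] linear_maps_closed[OF env_action_linear[OF V]])
  next
    case (mult f g)
    then show ?case
      by (simp add: env_action_mult[OF V] env_action_mult[OF W] linear_maps_closed[OF lin]
          linear_maps_closed[OF env_action_linear[OF V]])
  qed
  with v show ?thesis by blast
qed

lemma rep_morphism_module_map:
  assumes V: "representation K D V lam rho" and W: "representation K D W lam' rho'"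
    and \<phi>: "\<phi> \<in> rep_morphisms K D (V, lam, rho) (W, lam', rho')"
  shows "\<phi> \<in> linear_maps E (env_module K D (V, lam, rho)) (env_module K D (W, lam', rho'))"
proof (rule linear_mapsI)
  have lin: "\<phi> \<in> linear_maps K V W"
    using \<phi> by (simp add: rep_morphisms_def)
  show "\<phi> \<in> carrier (env_module K D (V, lam, rho)) \<rightarrow>\<^sub>E carrier (env_module K D (W, lam', rho'))"
    unfolding env_module_simps by (rule linear_maps_PiE[OF lin])
  fix x assume "x \<in> carrier (env_module K D (V, lam, rho))"
  then have x: "x \<in> carrier V" by (simp add: env_module_simps)
  show "\<phi> (x \<oplus>\<^bsub>env_module K D (V, lam, rho)\<^esub> y) = \<phi> x \<oplus>\<^bsub>env_module K D (W, lam', rho')\<^esub> \<phi> y"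
    if "y \<in> carrier (env_module K D (V, lam, rho))" for y
    using that x linear_maps_add[OF lin] by (simp add: env_module_simps)
  fix a assume "a \<in> carrier E"
  then obtain f where f: "f \<in> carrier F" "a = cls f"
    unfolding carrier_env by blast
  show "\<phi> (a \<odot>\<^bsub>env_module K D (V, lam, rho)\<^esub> x) = a \<odot>\<^bsub>env_module K D (W, lam', rho')\<^esub> \<phi> x"
    unfolding f(2) env_module_smult[OF V f(1)] env_module_smult[OF W f(1)]
    by (rule rep_morphism_intertwines[OF V W \<phi> f(1) x])
qed

section \<open>From modules to representations\<close>

lemma env_class_closed: "f \<in> carrier F \<Longrightarrow> cls f \<in> carrier E"
  unfolding carrier_env by (rule imageI)

lemma constant_closed: "a \<in> carrier K \<Longrightarrow> monomial K a [] \<in> carrier F"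
  by (rule monomial_closed) (simp_all add: lists.Nil)

context
  fixes M :: "(('d symbol list \<Rightarrow> 'k) set, 'v) module"
  assumes M: "left_module E M"
begin

interpretation M: left_module E M by (rule M)

lemma smult_env_class_closed:
  "f \<in> carrier F \<Longrightarrow> v \<in> carrier M \<Longrightarrow> cls f \<odot>\<^bsub>M\<^esub> v \<in> carrier M"
  by (intro M.smult_closed env_class_closed)

lemma module_scalar_restriction: "module K (scalar_restriction K D M)"
proof (rule moduleI)
  show "cring K" by (rule scalars.is_cring)
  show "abelian_group (scalar_restriction K D M)"
    by (rule abelian_group_congruence[OF M.abelian_group_axioms])
      (simp_all add: scalar_restriction_simps)
next
  fix x assume "x \<in> carrier (scalar_restriction K D M)"
  then have x: "x \<in> carrier M" by (simp add: scalar_restriction_simps)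
  show "\<one>\<^bsub>K\<^esub> \<odot>\<^bsub>scalar_restriction K D M\<^esub> x = x"
    unfolding scalar_restriction_simps one_eq_monomial[symmetric] ring_hom_one[OF env_class_hom]
    by (rule M.smult_one[OF x])
  fix a assume a: "a \<in> carrier K"
  show "a \<odot>\<^bsub>scalar_restriction K D M\<^esub> x \<in> carrier (scalar_restriction K D M)"
    unfolding scalar_restriction_simps by (intro smult_env_class_closed constant_closed a x)
  show "a \<odot>\<^bsub>scalar_restriction K D M\<^esub> (x \<oplus>\<^bsub>scalar_restriction K D M\<^esub> y)
      = a \<odot>\<^bsub>scalar_restriction K D M\<^esub> x \<oplus>\<^bsub>scalar_restriction K D M\<^esub> a \<odot>\<^bsub>scalar_restriction K D M\<^esub> y"
    if "y \<in> carrier (scalar_restriction K D M)" for y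
    using that unfolding scalar_restriction_simps
    by (intro M.smult_r_distr env_class_closed constant_closed a x)
  fix b assume b: "b \<in> carrier K"
  note hom = ring_hom_trans[OF scalar_ring_hom env_class_hom]
  show "(a \<oplus>\<^bsub>K\<^esub> b) \<odot>\<^bsub>scalar_restriction K D M\<^esub> x
      = a \<odot>\<^bsub>scalar_restriction K D M\<^esub> x \<oplus>\<^bsub>scalar_restriction K D M\<^esub> b \<odot>\<^bsub>scalar_restriction K D M\<^esub> x"
    unfolding scalar_restriction_simps ring_hom_add[OF hom a b, unfolded o_apply]
    by (intro M.smult_l_distr env_class_closed constant_closed a b x)
  show "(a \<otimes>\<^bsub>K\<^esub> b) \<odot>\<^bsub>scalar_restriction K D M\<^esub> x
      = a \<odot>\<^bsub>scalar_restriction K D M\<^esub> (b \<odot>\<^bsub>scalar_restriction K D M\<^esub> x)"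
    unfolding scalar_restriction_simps ring_hom_mult[OF hom a b, unfolded o_apply]
    by (intro M.smult_assoc env_class_closed constant_closed a b x)
qed

text \<open>The scalars of the enveloping algebra are central, hence every element of it acts linearly over
  them.\<close>

lemma smult_env_class_linear:
  assumes f: "f \<in> carrier F"
  shows "(\<lambda>v \<in> carrier M. cls f \<odot>\<^bsub>M\<^esub> v)
    \<in> linear_maps K (scalar_restriction K D M) (scalar_restriction K D M)"
proof (rule linear_mapsI, unfold scalar_restriction_simps)
  note closed = smult_env_class_closed env_class_closed constant_closed
  show "(\<lambda>v \<in> carrier M. cls f \<odot>\<^bsub>M\<^esub> v) \<in> carrier M \<rightarrow>\<^sub>E carrier M"
    using smult_env_class_closed[OF f] by auto
  fix x assume x: "x \<in> carrier M"
  show "(\<lambda>v \<in> carrier M. cls f \<odot>\<^bsub>M\<^esub> v) (x \<oplus>\<^bsub>M\<^esub> y)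
      = (\<lambda>v \<in> carrier M. cls f \<odot>\<^bsub>M\<^esub> v) x \<oplus>\<^bsub>M\<^esub> (\<lambda>v \<in> carrier M. cls f \<odot>\<^bsub>M\<^esub> v) y"
    if "y \<in> carrier M" for y
    using x that M.smult_r_distr[OF env_class_closed[OF f]] by simp
  fix a assume a: "a \<in> carrier K"
  have "cls f \<odot>\<^bsub>M\<^esub> (cls (monomial K a []) \<odot>\<^bsub>M\<^esub> x) = (cls f \<otimes>\<^bsub>E\<^esub> cls (monomial K a [])) \<odot>\<^bsub>M\<^esub> x"
    by (rule M.smult_assoc[symmetric]) (intro closed f a x)+
  also have "\<dots> = (cls (monomial K a []) \<otimes>\<^bsub>E\<^esub> cls f) \<odot>\<^bsub>M\<^esub> x"
    unfolding env_scalar_central[OF a f] ..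
  also have "\<dots> = cls (monomial K a []) \<odot>\<^bsub>M\<^esub> (cls f \<odot>\<^bsub>M\<^esub> x)"
    by (rule M.smult_assoc) (intro closed f a x)+
  finally show "(\<lambda>v \<in> carrier M. cls f \<odot>\<^bsub>M\<^esub> v) (cls (monomial K a []) \<odot>\<^bsub>M\<^esub> x)
      = cls (monomial K a []) \<odot>\<^bsub>M\<^esub> ((\<lambda>v \<in> carrier M. cls f \<odot>\<^bsub>M\<^esub> v) x)"
    using x smult_env_class_closed[OF constant_closed[OF a] x] by simp
qed

lemma compose_smult_env_class:
  assumes "f \<in> carrier F" "g \<in> carrier F"
  shows "compose (carrier M) (\<lambda>v \<in> carrier M. cls f \<odot>\<^bsub>M\<^esub> v) (\<lambda>v \<in> carrier M. cls g \<odot>\<^bsub>M\<^esub> v)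
    = (\<lambda>v \<in> carrier M. (cls f \<otimes>\<^bsub>E\<^esub> cls g) \<odot>\<^bsub>M\<^esub> v)"
  using smult_env_class_closed[OF assms(2)]
    M.smult_assoc[OF env_class_closed[OF assms(1)] env_class_closed[OF assms(2)]]
  by (auto simp: compose_def)

text \<open>Right inverses for \<open>\<turnstile>\<close> suffice. If \<open>x \<turnstile> y = e\<close> and \<open>y \<turnstile> z = e\<close>, then the actions satisfy
  \<open>r\<^sub>x r\<^sub>y = 1 = r\<^sub>y r\<^sub>z\<close>, whence \<open>r\<^sub>x = r\<^sub>x r\<^sub>y r\<^sub>z = r\<^sub>z\<close> and \<open>r\<^sub>y\<close> is a two-sided inverse of \<open>r\<^sub>x\<close>.\<close>

lemma R_class_bij:
  assumes x: "x \<in> carrier D"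
  shows "bij_betw (\<lambda>v \<in> carrier M. cls (free_gen K (R x)) \<odot>\<^bsub>M\<^esub> v) (carrier M) (carrier M)"
proof -
  let ?r = "\<lambda>x v. cls (free_gen K (R x)) \<odot>\<^bsub>M\<^esub> v"
  obtain e where e: "e \<in> halo D"
    using digroup.halo_nonempty by blast
  have cancel: "?r x (?r y v) = v"
    if xy: "x \<in> carrier D" "y \<in> carrier D" "x \<turnstile>\<^bsub>D\<^esub> y = e" and v: "v \<in> carrier M" for x y v
  proof -
    have "?r x (?r y v) = (cls (free_gen K (R x)) \<otimes>\<^bsub>E\<^esub> cls (free_gen K (R y))) \<odot>\<^bsub>M\<^esub> v"
      by (rule M.smult_assoc[symmetric]) (intro env_class_closed R_closed xy v)+
    also have "\<dots> = v"
      unfolding env_rprod[OF xy(1,2), symmetric] xy(3) env_unit[OF e] by (rule M.smult_one[OF v])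
    finally show ?thesis .
  qed
  obtain y where y: "y \<in> carrier D" "x \<turnstile>\<^bsub>D\<^esub> y = e"
    using digroup.right_inverse[OF e x] by blast
  obtain z where z: "z \<in> carrier D" "y \<turnstile>\<^bsub>D\<^esub> z = e"
    using digroup.right_inverse[OF e y(1)] by blast
  have closed: "?r u v \<in> carrier M" if "u \<in> carrier D" "v \<in> carrier M" for u v
    by (intro smult_env_class_closed R_closed that)
  have "?r y (?r x v) = v" if v: "v \<in> carrier M" for v
  proof -
    have "?r x v = ?r x (?r y (?r z v))"
      unfolding cancel[OF y(1) z v] ..
    also have "\<dots> = ?r z v"
      by (rule cancel[OF x y closed[OF z(1) v]])
    finally show ?thesis
      using cancel[OF y(1) z v] by simp
  qed
  then have "bij_betw (?r x) (carrier M) (carrier M)"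
    by (intro bij_betw_byWitness[where f' = "?r y"])
      (use cancel[OF x y] closed x y(1) in auto)
  then show ?thesis
    by (rule bij_betw_cong[THEN iffD1, rotated]) simp
qed

lemma representation_env_rep:
  "representation K D (scalar_restriction K D M)
     (\<lambda>x. \<lambda>v \<in> carrier M. cls (free_gen K (L x)) \<odot>\<^bsub>M\<^esub> v)
     (\<lambda>x. \<lambda>v \<in> carrier M. cls (free_gen K (R x)) \<odot>\<^bsub>M\<^esub> v)"
proof (intro representation.intro representation_axioms.intro, unfold scalar_restriction_simps)
  show "field K" by (rule scalars.field_axioms)
  show "generalized_digroup D" by (rule digroup.generalized_digroup_axioms)
  show "module K (scalar_restriction K D M)" by (rule module_scalar_restriction)
  show "(\<lambda>x. \<lambda>v \<in> carrier M. cls (free_gen K (L x)) \<odot>\<^bsub>M\<^esub> v)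
      \<in> carrier D \<rightarrow> linear_maps K (scalar_restriction K D M) (scalar_restriction K D M)"
    by (intro funcsetI smult_env_class_linear L_closed)
  show "(\<lambda>x. \<lambda>v \<in> carrier M. cls (free_gen K (R x)) \<odot>\<^bsub>M\<^esub> v)
      \<in> carrier D \<rightarrow> linear_auts K (scalar_restriction K D M)"
    unfolding linear_auts_def scalar_restriction_simps
    by (intro funcsetI CollectI conjI smult_env_class_linear R_closed R_class_bij)
next
  fix e assume e: "e \<in> halo D"
  show "(\<lambda>v \<in> carrier M. cls (free_gen K (R e)) \<odot>\<^bsub>M\<^esub> v) = (\<lambda>v \<in> carrier M. v)"
    unfolding env_unit[OF e] using M.smult_one by (rule restrict_ext)
next
  fix x y assume x: "x \<in> carrier D" and y: "y \<in> carrier D"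
  note compose = compose_smult_env_class[OF L_closed[OF x] L_closed[OF y]]
    compose_smult_env_class[OF R_closed[OF x] R_closed[OF y]]
    compose_smult_env_class[OF R_closed[OF x] L_closed[OF y]]
    compose_smult_env_class[OF L_closed[OF x] R_closed[OF y]]
  show "(\<lambda>v \<in> carrier M. cls (free_gen K (L (x \<stileturn>\<^bsub>D\<^esub> y))) \<odot>\<^bsub>M\<^esub> v)
      = compose (carrier M) (\<lambda>v \<in> carrier M. cls (free_gen K (L x)) \<odot>\<^bsub>M\<^esub> v)
          (\<lambda>v \<in> carrier M. cls (free_gen K (L y)) \<odot>\<^bsub>M\<^esub> v)"
    unfolding compose env_lprod[OF x y] ..
  show "(\<lambda>v \<in> carrier M. cls (free_gen K (R (x \<turnstile>\<^bsub>D\<^esub> y))) \<odot>\<^bsub>M\<^esub> v)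
      = compose (carrier M) (\<lambda>v \<in> carrier M. cls (free_gen K (R x)) \<odot>\<^bsub>M\<^esub> v)
          (\<lambda>v \<in> carrier M. cls (free_gen K (R y)) \<odot>\<^bsub>M\<^esub> v)"
    unfolding compose env_rprod[OF x y] ..
  show "compose (carrier M) (\<lambda>v \<in> carrier M. cls (free_gen K (R x)) \<odot>\<^bsub>M\<^esub> v)
          (\<lambda>v \<in> carrier M. cls (free_gen K (L y)) \<odot>\<^bsub>M\<^esub> v)
      = (\<lambda>v \<in> carrier M. cls (free_gen K (L (x \<turnstile>\<^bsub>D\<^esub> y))) \<odot>\<^bsub>M\<^esub> v)"
    unfolding compose env_R_L[OF x y] ..
  show "compose (carrier M) (\<lambda>v \<in> carrier M. cls (free_gen K (L x)) \<odot>\<^bsub>M\<^esub> v)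
          (\<lambda>v \<in> carrier M. cls (free_gen K (R y)) \<odot>\<^bsub>M\<^esub> v)
      = (\<lambda>v \<in> carrier M. cls (free_gen K (L (x \<stileturn>\<^bsub>D\<^esub> y))) \<odot>\<^bsub>M\<^esub> v)"
    unfolding compose env_L_R[OF x y] ..
qed

text \<open>Both sides are multiplicative and additive in \<open>f\<close>, so it is enough that they agree on scalars
  and generators, where they agree by construction.\<close>

lemma env_action_env_rep:
  assumes "f \<in> carrier F"
  shows "\<forall>v \<in> carrier M. env_action K (env_rep K D M) f v = cls f \<odot>\<^bsub>M\<^esub> v"
  using assms
proof (induction rule: generator_induct)
  case (scalar a)
  then show ?case
    unfolding env_rep_def env_action_scalar[OF representation_env_rep scalar]
    by (simp add: homothety_def scalar_restriction_simps)
next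
  case (gen s)
  then show ?case
    unfolding env_rep_def by (auto simp: env_action_L[OF representation_env_rep] env_action_R[OF representation_env_rep])
next
  case (add f g)
  show ?case
  proof
    fix v assume v: "v \<in> carrier M"
    have "env_action K (env_rep K D M) (f \<oplus>\<^bsub>F\<^esub> g) v
      = env_action K (env_rep K D M) f v \<oplus>\<^bsub>M\<^esub> env_action K (env_rep K D M) g v"
      unfolding env_rep_def using env_action_add[OF representation_env_rep add(1,2), of v] v
      by (simp add: scalar_restriction_simps)
    also have "\<dots> = (cls f \<oplus>\<^bsub>E\<^esub> cls g) \<odot>\<^bsub>M\<^esub> v"
      using add(3,4) v M.smult_l_distr[OF env_class_closed[OF add(1)] env_class_closed[OF add(2)] v]
      by simp
    finally show "env_action K (env_rep K D M) (f \<oplus>\<^bsub>F\<^esub> g) v = cls (f \<oplus>\<^bsub>F\<^esub> g) \<odot>\<^bsub>M\<^esub> v"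
      unfolding ring_hom_add[OF env_class_hom add(1,2)] .
  qed
next
  case (mult f g)
  show ?case
  proof
    fix v assume v: "v \<in> carrier M"
    have "env_action K (env_rep K D M) (f \<otimes>\<^bsub>F\<^esub> g) v
      = env_action K (env_rep K D M) f (env_action K (env_rep K D M) g v)"
      unfolding env_rep_def using env_action_mult[OF representation_env_rep mult(1,2), of v] v
      by (simp add: scalar_restriction_simps)
    also have "\<dots> = (cls f \<otimes>\<^bsub>E\<^esub> cls g) \<odot>\<^bsub>M\<^esub> v"
      using mult(3,4) v smult_env_class_closed[OF mult(2) v]
        M.smult_assoc[OF env_class_closed[OF mult(1)] env_class_closed[OF mult(2)] v]
      by simp
    finally show "env_action K (env_rep K D M) (f \<otimes>\<^bsub>F\<^esub> g) v = cls (f \<otimes>\<^bsub>F\<^esub> g) \<odot>\<^bsub>M\<^esub> v"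
      unfolding ring_hom_mult[OF env_class_hom mult(1,2)] .
  qed
qed

lemma env_module_env_rep:
  shows "carrier (env_module K D (env_rep K D M)) = carrier M"
    and "add (env_module K D (env_rep K D M)) = add M"
    and "a \<in> carrier E \<Longrightarrow> v \<in> carrier M \<Longrightarrow>
      a \<odot>\<^bsub>env_module K D (env_rep K D M)\<^esub> v = a \<odot>\<^bsub>M\<^esub> v"
proof -
  show "carrier (env_module K D (env_rep K D M)) = carrier M"
    and "add (env_module K D (env_rep K D M)) = add M"
    by (simp_all add: env_rep_def env_module_simps scalar_restriction_simps)
  assume "a \<in> carrier E" and v: "v \<in> carrier M"
  then obtain f where f: "f \<in> carrier F" "a = cls f"
    unfolding carrier_env by blast
  show "a \<odot>\<^bsub>env_module K D (env_rep K D M)\<^esub> v = a \<odot>\<^bsub>M\<^esub> v"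
    using env_action_env_rep[OF f(1)] v
    unfolding f(2) env_rep_def env_module_smult[OF representation_env_rep f(1)] by blast
qed

end

lemma module_map_rep_morphism:
  assumes M: "left_module E M" and N: "left_module E N" and f: "f \<in> linear_maps E M N"
  shows "f \<in> rep_morphisms K D (env_rep K D M) (env_rep K D N)"
proof -
  have lin: "f \<in> linear_maps K (scalar_restriction K D M) (scalar_restriction K D N)"
  proof (rule linear_mapsI, unfold scalar_restriction_simps)
    show "f \<in> carrier M \<rightarrow>\<^sub>E carrier N" by (rule linear_maps_PiE[OF f])
  qed (auto intro: linear_maps_add[OF f] linear_maps_smult[OF f] env_class_closed constant_closed)
  have commute: "compose (carrier M) f (\<lambda>v \<in> carrier M. cls g \<odot>\<^bsub>M\<^esub> v)
      = compose (carrier M) (\<lambda>v \<in> carrier N. cls g \<odot>\<^bsub>N\<^esub> v) f"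
    if g: "g \<in> carrier F" for g
    using linear_maps_closed[OF f] linear_maps_smult[OF f env_class_closed[OF g]]
    by (auto simp: compose_def)
  show ?thesis
    unfolding rep_morphisms_def env_rep_def prod.case scalar_restriction_simps
    using lin commute[OF L_closed] commute[OF R_closed] by blast
qed

end

section \<open>The equivalence\<close>

lemma left_module_category_simps:
  "obj (left_module_category A) = {M. left_module A M}"
  "arr (left_module_category A) = linear_maps A"
  "ident (left_module_category A) M = (\<lambda>x \<in> carrier M. x)"
  "comp (left_module_category A) M N P g f = compose (carrier M) g f"
  by (simp_all add: left_module_category_def)

lemma rep_category_simps:
  "obj (rep_category K D) = {(V, lam, rho). representation K D V lam rho}"
  "arr (rep_category K D) = rep_morphisms K D"
  "ident (rep_category K D) (V, lam, rho) = (\<lambda>v \<in> carrier V. v)"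
  "comp (rep_category K D) (V, lam, rho) Y Z g f = compose (carrier V) g f"
  by (simp_all add: rep_category_def)

lemma linear_maps_id_left: "f \<in> linear_maps K V W \<Longrightarrow> compose (carrier V) (\<lambda>x \<in> carrier W. x) f = f"
  and linear_maps_id_right: "f \<in> linear_maps K V W \<Longrightarrow> compose (carrier V) f (\<lambda>x \<in> carrier V. x) = f"
  using linear_maps_PiE[of f K V W] by (auto simp: Id_compose compose_Id PiE_def)

lemma linear_maps_assoc:
  assumes "f \<in> linear_maps K U V"
  shows "compose (carrier U) h (compose (carrier U) g f) = compose (carrier U) (compose (carrier V) h g) f"
  using linear_maps_closed[OF assms] by (auto simp: compose_def)

lemma category_left_module: "category (left_module_category A)"
proof (rule category.intro, unfold left_module_category_simps mem_Collect_eq)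
  show "(\<lambda>x \<in> carrier M. x) \<in> linear_maps A M M" if "left_module A M" for M
  proof -
    interpret left_module A M by (rule that)
    show ?thesis
      by (rule linear_mapsI) (simp_all add: smult_closed)
  qed
  show "compose (carrier M) g f \<in> linear_maps A M P"
    if M: "left_module A M" and f: "f \<in> linear_maps A M N" and g: "g \<in> linear_maps A N P"
    for M N P f g
  proof -
    interpret left_module A M by (rule M)
    show ?thesis
      by (rule linear_maps_compose[OF f g]) (simp_all add: smult_closed)
  qed
qed (auto intro: linear_maps_id_left linear_maps_id_right linear_maps_assoc)

lemma rep_morphisms_iff:
  "f \<in> rep_morphisms K D (V, lam, rho) (W, lam', rho') \<longleftrightarrow>
     f \<in> linear_maps K V W \<and>
     (\<forall>x \<in> carrier D. \<forall>v \<in> carrier V. f (lam x v) = lam' x (f v) \<and> f (rho x v) = rho' x (f v))"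
proof -
  have "compose (carrier V) f g = compose (carrier V) h f \<longleftrightarrow> (\<forall>v \<in> carrier V. f (g v) = h (f v))"
    for g h
    by (auto simp: compose_def restrict_def fun_eq_iff)
  then show ?thesis
    by (auto simp: rep_morphisms_def)
qed

lemma category_rep:
  fixes K :: "('k, 'c) ring_scheme" and D :: "'d digroup"
  shows "category (rep_category K D :: (('k, 'd, 'v) rep, 'v \<Rightarrow> 'v) category)"
proof (rule category.intro, unfold rep_category_simps)
  note closed = linear_maps_closed[OF representation.lam_End[THEN funcset_mem]]
    linear_maps_closed[OF representation.rho_Aut[THEN funcset_mem, unfolded linear_auts_def,
      THEN CollectD, THEN conjunct1]]
  fix X :: "('k, 'd, 'v) rep"
  assume "X \<in> {(V, lam, rho). representation K D V lam rho}"
  then obtain V lam rho where X: "X = (V, lam, rho)" and rep: "representation K D V lam rho"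
    by auto
  interpret representation K D V lam rho by (rule rep)
  show "ident (rep_category K D) X \<in> rep_morphisms K D X X"
    unfolding X rep_category_simps rep_morphisms_iff
    using closed[OF rep]
    by (auto intro!: linear_mapsI)
  fix Y :: "('k, 'd, 'v) rep"
  assume "Y \<in> {(V, lam, rho). representation K D V lam rho}"
  then obtain W lam' rho' where Y: "Y = (W, lam', rho')"
    by auto
  fix f assume f: "f \<in> rep_morphisms K D X Y"
  then have lin: "f \<in> linear_maps K V W"
    unfolding X Y rep_morphisms_iff by blast
  show "comp (rep_category K D) X X Y f (ident (rep_category K D) X) = f"
    unfolding X rep_category_simps by (rule linear_maps_id_right[OF lin])
  show "comp (rep_category K D) X Y Y (ident (rep_category K D) Y) f = f"
    unfolding X Y rep_category_simps by (rule linear_maps_id_left[OF lin])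
  fix Z :: "('k, 'd, 'v) rep"
  assume "Z \<in> {(V, lam, rho). representation K D V lam rho}"
  then obtain U lam'' rho'' where Z: "Z = (U, lam'', rho'')"
    by auto
  fix g assume g: "g \<in> rep_morphisms K D Y Z"
  show "comp (rep_category K D) X Y Z g f \<in> rep_morphisms K D X Z"
    using f g closed[OF rep] linear_maps_closed[OF lin]
      linear_maps_compose_closed[OF vectors.module_axioms lin]
    unfolding X Y Z rep_category_simps rep_morphisms_iff
    by (auto simp: compose_eq)
next
  fix W X Y Z :: "('k, 'd, 'v) rep" and f g h
  assume f: "f \<in> rep_morphisms K D W X"
  obtain V lam rho V' lam' rho' where W: "W = (V, lam, rho)" and X: "X = (V', lam', rho')"
    by (metis prod_cases3)
  have "f \<in> linear_maps K V V'"
    using f unfolding W X rep_morphisms_iff by blast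
  then show "comp (rep_category K D) W Y Z h (comp (rep_category K D) W X Y g f)
      = comp (rep_category K D) W X Z (comp (rep_category K D) X Y Z h g) f"
    unfolding W X rep_category_simps by (rule linear_maps_assoc)
qed

definition env_module_functor ::
  "('k, 'c) ring_scheme \<Rightarrow> 'd digroup \<Rightarrow>
    (('k, 'd, 'v) rep, 'v \<Rightarrow> 'v, (('d symbol list \<Rightarrow> 'k) set, 'v) module, 'v \<Rightarrow> 'v) cat_functor"
where
  "env_module_functor K D = \<lparr>on_obj = env_module K D, on_arr = (\<lambda>X Y f. f)\<rparr>"

definition env_rep_functor ::
  "('k, 'c) ring_scheme \<Rightarrow> 'd digroup \<Rightarrow>
    ((('d symbol list \<Rightarrow> 'k) set, 'v) module, 'v \<Rightarrow> 'v, ('k, 'd, 'v) rep, 'v \<Rightarrow> 'v) cat_functor"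
where
  "env_rep_functor K D = \<lparr>on_obj = env_rep K D, on_arr = (\<lambda>X Y f. f)\<rparr>"

context enveloping_setting
begin

lemma functor_env_module:
  "cat_functor (rep_category K D) (left_module_category E) (env_module_functor K D)"
  by (intro cat_functor.intro category_rep category_left_module cat_functor_axioms.intro)
    (auto simp: env_module_functor_def rep_category_simps left_module_category_simps
      env_module_simps left_module_env_module rep_morphism_module_map)

lemma functor_env_rep:
  "cat_functor (left_module_category E) (rep_category K D) (env_rep_functor K D)"
proof (intro cat_functor.intro category_rep category_left_module cat_functor_axioms.intro)
  show "on_obj (env_rep_functor K D) M \<in> obj (rep_category K D)"
    if "M \<in> obj (left_module_category E)" for M :: "(('d symbol list \<Rightarrow> 'k) set, 'v) module"
    using representation_env_rep that
    by (simp add: env_rep_functor_def env_rep_def rep_category_simps left_module_category_simps)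
  show "on_arr (env_rep_functor K D) M N f
      \<in> arr (rep_category K D) (on_obj (env_rep_functor K D) M) (on_obj (env_rep_functor K D) N)"
    if "M \<in> obj (left_module_category E)" "N \<in> obj (left_module_category E)"
      "f \<in> arr (left_module_category E) M N"
    for M N :: "(('d symbol list \<Rightarrow> 'k) set, 'v) module" and f
    using module_map_rep_morphism that
    by (simp add: env_rep_functor_def rep_category_simps left_module_category_simps)
qed (auto simp: env_rep_functor_def env_rep_def rep_category_simps left_module_category_simps
      scalar_restriction_simps)

text \<open>The new operators are the restrictions to the carrier of the action of \<open>L x\<close> and \<open>R x\<close> on the
  module, which is that of \<open>\<lambda>\<^sub>x\<close> and \<open>\<rho>\<^sub>x\<close>, and the scalars act as homotheties. Hence the identity
  function of the carrier is a morphism in both directions.\<close>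

lemma unit_isomorphism:
  "naturally_isomorphic (rep_category K D) (rep_category K D) identity_functor
     (compose_functor (env_rep_functor K D) (env_module_functor K D) ::
       (('k, 'd, 'v) rep, 'v \<Rightarrow> 'v, ('k, 'd, 'v) rep, 'v \<Rightarrow> 'v) cat_functor)"
  unfolding naturally_isomorphic_def
proof (intro exI conjI ballI)
  let ?GF = "\<lambda>X. env_rep K D (env_module K D X)"
  fix X :: "('k, 'd, 'v) rep"
  assume "X \<in> obj (rep_category K D)"
  then obtain V lam rho where X: "X = (V, lam, rho)" and rep: "representation K D V lam rho"
    by (auto simp: rep_category_simps)
  interpret V: module K V by (rule rep_module[OF rep])
  let ?M = "env_module K D X"
  have carrier: "carrier ?M = carrier V" and add: "add ?M = add V"
    unfolding X by (simp_all add: env_module_simps)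
  have smult: "cls f \<odot>\<^bsub>?M\<^esub> v = env_action K (V, lam, rho) f v" if "f \<in> carrier F" for f v
    unfolding X by (rule env_module_smult[OF rep that])
  have L: "cls (free_gen K (L x)) \<odot>\<^bsub>?M\<^esub> v = lam x v"
    and R: "cls (free_gen K (R x)) \<odot>\<^bsub>?M\<^esub> v = rho x v" if "x \<in> carrier D" for x v
    unfolding smult[OF L_closed[OF that]] smult[OF R_closed[OF that]]
      env_action_L[OF rep that] env_action_R[OF rep that] by simp_all
  have scalar: "cls (monomial K a []) \<odot>\<^bsub>?M\<^esub> v = a \<odot>\<^bsub>V\<^esub> v"
    if "a \<in> carrier K" "v \<in> carrier V" for a v
    unfolding smult[OF constant_closed[OF that(1)]] env_action_scalar[OF rep that(1)]
    using that(2) by (simp add: homothety_def)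
  have lam: "lam x v \<in> carrier V" and rho: "rho x v \<in> carrier V"
    if "x \<in> carrier D" "v \<in> carrier V" for x v
    using rep_linear[OF rep that(1)] that(2) by (auto intro: linear_maps_closed)
  have "(\<lambda>v \<in> carrier V. v) \<in> rep_morphisms K D X (?GF X)"
    unfolding env_rep_def X rep_morphisms_iff
    unfolding X[symmetric]
    by (auto simp: scalar_restriction_simps carrier add L R scalar lam rho intro!: linear_mapsI)
  moreover have "(\<lambda>v \<in> carrier V. v) \<in> rep_morphisms K D (?GF X) X"
    unfolding env_rep_def X rep_morphisms_iff
    unfolding X[symmetric]
    by (auto simp: scalar_restriction_simps carrier add L R scalar lam rho intro!: linear_mapsI)
  moreover have "ident (rep_category K D) X = (\<lambda>v \<in> carrier V. v)"
    "ident (rep_category K D) (?GF X) = (\<lambda>v \<in> carrier V. v)"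
    "comp (rep_category K D) X Y Z g f = compose (carrier V) g f"
    "comp (rep_category K D) (?GF X) Y Z g f = compose (carrier V) g f" for Y Z f g
    unfolding env_rep_def by (simp_all add: X rep_category_simps scalar_restriction_simps env_module_simps)
  moreover have "compose (carrier V) (\<lambda>v \<in> carrier V. v) (\<lambda>v \<in> carrier V. v) = (\<lambda>v \<in> carrier V. v)"
    by (simp add: compose_def restrict_def fun_eq_iff)
  ultimately show "ident (rep_category K D) X
      \<in> iso_arrows (rep_category K D) (on_obj identity_functor X)
          (on_obj (compose_functor (env_rep_functor K D) (env_module_functor K D)) X)"
    unfolding iso_arrows_def
    by (auto simp: identity_functor_def compose_functor_def env_rep_functor_def
        env_module_functor_def rep_category_simps(2))
  fix Y f
  assume "Y \<in> obj (rep_category K D)" and f: "f \<in> arr (rep_category K D) X Y"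
  then obtain W lam' rho' where Y: "Y = (W, lam', rho')"
    by (auto simp: rep_category_simps)
  from f have "f \<in> linear_maps K V W"
    unfolding X Y rep_category_simps rep_morphisms_iff by blast
  then show "comp (rep_category K D) (on_obj identity_functor X) (on_obj identity_functor Y)
        (on_obj (compose_functor (env_rep_functor K D) (env_module_functor K D)) Y)
        (ident (rep_category K D) Y) (on_arr identity_functor X Y f)
      = comp (rep_category K D) (on_obj identity_functor X)
        (on_obj (compose_functor (env_rep_functor K D) (env_module_functor K D)) X)
        (on_obj (compose_functor (env_rep_functor K D) (env_module_functor K D)) Y)
        (on_arr (compose_functor (env_rep_functor K D) (env_module_functor K D)) X Y f)
        (ident (rep_category K D) X)"
    by (simp add: X Y identity_functor_def compose_functor_def env_rep_functor_def
        env_module_functor_def rep_category_simps linear_maps_id_left linear_maps_id_right)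
qed

text \<open>By \<open>env_module_env_rep\<close> the composite functor returns a module with the same carrier and
  addition on which the elements of the algebra act as before. Hence the identity function of the
  carrier is linear in both directions.\<close>

lemma counit_isomorphism:
  "naturally_isomorphic (left_module_category E) (left_module_category E)
     (compose_functor (env_module_functor K D) (env_rep_functor K D) ::
       ((('d symbol list \<Rightarrow> 'k) set, 'v) module, 'v \<Rightarrow> 'v,
        (('d symbol list \<Rightarrow> 'k) set, 'v) module, 'v \<Rightarrow> 'v) cat_functor)
     identity_functor"
  unfolding naturally_isomorphic_def
proof (intro exI conjI ballI)
  let ?FG = "\<lambda>M. env_module K D (env_rep K D M)"
  fix M :: "(('d symbol list \<Rightarrow> 'k) set, 'v) module"
  assume "M \<in> obj (left_module_category E)"
  then have M: "left_module E M"
    by (simp add: left_module_category_simps)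
  interpret M: left_module E M by (rule M)
  note FG = env_module_env_rep[OF M]
  have "(\<lambda>v \<in> carrier M. v) \<in> linear_maps E (?FG M) M" "(\<lambda>v \<in> carrier M. v) \<in> linear_maps E M (?FG M)"
    by (auto simp: FG M.smult_closed intro!: linear_mapsI)
  moreover have "compose (carrier M) (\<lambda>v \<in> carrier M. v) (\<lambda>v \<in> carrier M. v) = (\<lambda>v \<in> carrier M. v)"
    by (simp add: compose_def restrict_def fun_eq_iff)
  ultimately show "ident (left_module_category E) M
      \<in> iso_arrows (left_module_category E)
          (on_obj (compose_functor (env_module_functor K D) (env_rep_functor K D)) M)
          (on_obj identity_functor M)"
    unfolding iso_arrows_def
    by (auto simp: identity_functor_def compose_functor_def env_rep_functor_def
        env_module_functor_def left_module_category_simps FG)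
  fix N f
  assume "N \<in> obj (left_module_category E)" and "f \<in> arr (left_module_category E) M N"
  then have "f \<in> linear_maps E M N"
    by (simp add: left_module_category_simps)
  then show "comp (left_module_category E)
        (on_obj (compose_functor (env_module_functor K D) (env_rep_functor K D)) M)
        (on_obj (compose_functor (env_module_functor K D) (env_rep_functor K D)) N)
        (on_obj identity_functor N) (ident (left_module_category E) N)
        (on_arr (compose_functor (env_module_functor K D) (env_rep_functor K D)) M N f)
      = comp (left_module_category E)
        (on_obj (compose_functor (env_module_functor K D) (env_rep_functor K D)) M)
        (on_obj identity_functor M) (on_obj identity_functor N)
        (on_arr identity_functor M N f) (ident (left_module_category E) M)"
    by (simp add: identity_functor_def compose_functor_def env_rep_functor_def
        env_module_functor_def left_module_category_simps FG linear_maps_id_left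
        linear_maps_id_right)
qed

end

theorem theorem20:
  fixes K :: "('k, 'c) ring_scheme" and D :: "'d digroup"
  assumes "field K" and "generalized_digroup D"
  shows "equivalent_categories
    (rep_category K D :: (('k, 'd, 'v) rep, 'v \<Rightarrow> 'v) category)
    (left_module_category (enveloping_algebra K D)
      :: ((('d symbol list \<Rightarrow> 'k) set, 'v) module, 'v \<Rightarrow> 'v) category)"
proof -
  interpret enveloping_setting K D
    using assms cring_def domain.axioms(1) field.axioms(1)
    by (intro enveloping_setting.intro free_algebra_setting.intro) auto
  show ?thesis
    unfolding equivalent_categories_def
    using functor_env_module functor_env_rep unit_isomorphism counit_isomorphism by blast
qed

end
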